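(* Let $\mathcal{A}$ be a semi-abelian category satisfying the Smith is Huq condition (SH), and let $\xi^M_N\colon M\flat N\to N$ and $\xi^N_M\colon N\flat M\to M$ be compatible internal actions in $\mathcal{A}$. Then the Peiffer product $M\bowtie N$ and the strong Peiffer product $M\bowtie_S N$ are isomorphic.
   Context: A semi-abelian category is a pointed, Barr exact, Bourn protomodular category with binary coproducts. (SH): two internal equivalence relations on the same object centralise each other in the Smith–Pedicchio sense as soon as their normalisations (the corresponding normal subobjects) commute in the sense of Huq. Notation: $+$ is the coproduct (with $A+B$ and $B+A$ identified), $i_A\colon A\to A+B$ and $i_B\colon B\to A+B$ are the inclusions, $[f,g]\colon A+B\to C$ is the morphism induced by $f\colon A\to C$, $g\colon B\to C$. The functor $\flat$: $k_{A,B}\colon A\flat B\to A+B$ is the kernel of $[1_A,0]\colon A+B\to A$; for $f\colon A\to A'$, $g\colon B\to B'$, $f\flat g$ is the restriction of $f+g$ to kernels. For fixed $A$, $A\flat(-)$ is a monad with unit $\eta^A_B\colon B\to A\flat B$ determined by $k_{A,B}\circ\eta^A_B=i_B$ and multiplication $\mu^A_B\colon A\flat(A\flat B)\to A\flat B$ determined by $k_{A,B}\circ\mu^A_B=[i_A,k_{A,B}]\circ k_{A,A\flat B}$. An internal action of $A$ on $X$ is a morphism $\xi\colon A\flat X\to X$ making $X$ an algebra for this monad. The conjugation action is $\chi_A=[1_A,1_A]\circ k_{A,A}\colon A\flat A\to A$. Cosmash products: $h_{A,B}\colon A\diamond B\to A+B$ is the kernel of the canonical morphism $A+B\to A\times B$;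 it factors as $h_{A,B}=k_{A,B}\circ i_{A,B}$ with $i_{A,B}\colon A\diamond B\to A\flat B$. $h_{A,B,C}\colon A\diamond B\diamond C\to A+B+C$ is the kernel of the morphism $A+B+C\to(A+B)\times(A+C)\times(B+C)$ with components $[i_A,i_B,0]$, $[i_A,0,i_C]$, $[0,i_B,i_C]$. The morphism $j_{A,B,C}\colon A\diamond B\diamond C\to(A+B)\flat C$ is the unique one with $k_{A+B,C}\circ j_{A,B,C}=h_{A,B,C}$. The folding morphism $S^{N,M}_{1,2}\colon M\diamond N\diamond M\to N\diamond M$ is the unique one such that $h_{N,M}\circ S^{N,M}_{1,2}$ equals $h_{M,N,M}$ followed by the morphism $M+N+M\to M+N$ which folds the two copies of $M$ by the codiagonal and is the identity on $N$. Similarly $S^{M,N}_{1,2}\colon M\diamond N\diamond N\to M\diamond N$ is induced by folding the two copies of $N$. Compatibility: internal actions $\xi^M_N\colon M\flat N\to N$ and $\xi^N_M\colon N\flat M\to M$ are compatible if there exist internal actions $\xi^{M+N}_M\colon(M+N)\flat M\to M$ and $\xi^{M+N}_N\colon(M+N)\flat N\to N$ (these are then uniquely determined) such that: (CA.0) $\xi^{M+N}_M\circ(i_N\flat 1_M)=\xi^N_M$, $\ \xi^{M+N}_M\circ(i_M\flat 1_M)=\chi_M$, $\ \xi^{M+N}_M\circ j_{M,N,M}=\xi^N_M\circ i_{N,M}\circ S^{N,M}_{1,2}$, and $\xi^{M+N}_N\circ(i_M\flat 1_N)=\xi^M_N$, $\ \xi^{M+N}_N\circ(i_N\flat 1_N)=\chi_N$,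 $\ \xi^{M+N}_N\circ j_{M,N,N}=\xi^M_N\circ i_{M,N}\circ S^{M,N}_{1,2}$; (CA.M) $\xi^{M+N}_M\circ\big((\xi^N_M+\xi^M_N)\flat 1_M\big)=\xi^{M+N}_M\circ\big([k_{N,M},k_{M,N}]\flat 1_M\big)$ as morphisms $((N\flat M)+(M\flat N))\flat M\to M$; (CA.N) $\xi^{M+N}_N\circ\big((\xi^N_M+\xi^M_N)\flat 1_N\big)=\xi^{M+N}_N\circ\big([k_{N,M},k_{M,N}]\flat 1_N\big)$ as morphisms $((N\flat M)+(M\flat N))\flat N\to N$. Peiffer product: $q\colon M+N\to M\bowtie N$ is the coequaliser of the two morphisms $[k_{N,M},k_{M,N}]$ and $\xi^N_M+\xi^M_N$ from $(N\flat M)+(M\flat N)$ to $M+N$. Strong Peiffer product (for compatible actions): $q_S\colon M+N\to M\bowtie_S N$ is the coequaliser of the two morphisms $\chi_{M+N}\circ[1_{M+N}\flat i_M,\ 1_{M+N}\flat i_N]$ and $\xi^{M+N}_M+\xi^{M+N}_N$ from $((M+N)\flat M)+((M+N)\flat N)$ to $M+N$. *)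

theory Defs
  imports Main
begin

record ('o, 'm) cat =
  Obj :: "'o set"
  Arr :: "'m set"
  Dom :: "'m \<Rightarrow> 'o"
  Cod :: "'m \<Rightarrow> 'o"
  Id :: "'o \<Rightarrow> 'm"
  Comp :: "'m \<Rightarrow> 'm \<Rightarrow> 'm" (infixl "\<cdot>\<index>" 70)

definition hom :: "('o, 'm) cat \<Rightarrow> 'o \<Rightarrow> 'o \<Rightarrow> 'm set" where
  "hom C A B = {f \<in> Arr C. Dom C f = A \<and> Cod C f = B}"

locale category =
  fixes C :: "('o, 'm) cat" (structure)
  assumes Dom_in_Obj: "f \<in> Arr C \<Longrightarrow> Dom C f \<in> Obj C"
    and Cod_in_Obj: "f \<in> Arr C \<Longrightarrow> Cod C f \<in> Obj C"
    and Id_in_hom: "A \<in> Obj C \<Longrightarrow> Id C A \<in> hom C A A"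
    and Comp_in_hom: "\<lbrakk>f \<in> hom C X Y; g \<in> hom C Y Z\<rbrakk> \<Longrightarrow> g \<cdot> f \<in> hom C X Z"
    and Comp_assoc: "\<lbrakk>f \<in> hom C W X; g \<in> hom C X Y; h \<in> hom C Y Z\<rbrakk>
      \<Longrightarrow> h \<cdot> (g \<cdot> f) = h \<cdot> g \<cdot> f"
    and Comp_Id: "f \<in> hom C X Y \<Longrightarrow> f \<cdot> Id C X = f"
    and Id_Comp: "f \<in> hom C X Y \<Longrightarrow> Id C Y \<cdot> f = f"
begin

definition iso :: "'m \<Rightarrow> bool" where
  "iso f \<longleftrightarrow> f \<in> Arr C \<and>
    (\<exists>g \<in> hom C (Cod C f) (Dom C f). g \<cdot> f = Id C (Dom C f) \<and> f \<cdot> g = Id C (Cod C f))"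

definition isomorphic :: "'o \<Rightarrow> 'o \<Rightarrow> bool" where
  "isomorphic A B \<longleftrightarrow> (\<exists>f \<in> hom C A B. iso f)"


subsection \<open>Limits and colimits\<close>

definition is_terminal :: "'o \<Rightarrow> bool" where
  "is_terminal Z \<longleftrightarrow> Z \<in> Obj C \<and> (\<forall>A \<in> Obj C. \<exists>!f. f \<in> hom C A Z)"

definition is_initial :: "'o \<Rightarrow> bool" where
  "is_initial Z \<longleftrightarrow> Z \<in> Obj C \<and> (\<forall>A \<in> Obj C. \<exists>!f. f \<in> hom C Z A)"

definition is_zero_object :: "'o \<Rightarrow> bool" where
  "is_zero_object Z \<longleftrightarrow> is_initial Z \<and> is_terminal Z"

definition pointed :: bool where
  "pointed \<longleftrightarrow> (\<exists>Z. is_zero_object Z)"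

definition zero :: "'o \<Rightarrow> 'o \<Rightarrow> 'm" where
  "zero A B = (THE f. \<exists>Z u v. is_zero_object Z \<and> u \<in> hom C A Z \<and> v \<in> hom C Z B \<and> f = v \<cdot> u)"

definition is_product :: "'o \<Rightarrow> 'o \<Rightarrow> 'm \<Rightarrow> 'm \<Rightarrow> bool" where
  "is_product A B p q \<longleftrightarrow>
    p \<in> hom C (Dom C p) A \<and> q \<in> hom C (Dom C p) B \<and>
    (\<forall>Y. \<forall>f \<in> hom C Y A. \<forall>g \<in> hom C Y B. \<exists>!h. h \<in> hom C Y (Dom C p) \<and> p \<cdot> h = f \<and> q \<cdot> h = g)"

definition is_coproduct :: "'o \<Rightarrow> 'o \<Rightarrow> 'm \<Rightarrow> 'm \<Rightarrow> bool" where
  "is_coproduct A B i j \<longleftrightarrow>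
    i \<in> hom C A (Cod C i) \<and> j \<in> hom C B (Cod C i) \<and>
    (\<forall>Y. \<forall>f \<in> hom C A Y. \<forall>g \<in> hom C B Y. \<exists>!h. h \<in> hom C (Cod C i) Y \<and> h \<cdot> i = f \<and> h \<cdot> j = g)"

definition is_pullback :: "'m \<Rightarrow> 'm \<Rightarrow> 'm \<Rightarrow> 'm \<Rightarrow> bool" where
  "is_pullback f g p q \<longleftrightarrow>
    f \<in> Arr C \<and> g \<in> hom C (Dom C g) (Cod C f) \<and>
    p \<in> hom C (Dom C p) (Dom C f) \<and> q \<in> hom C (Dom C p) (Dom C g) \<and>
    f \<cdot> p = g \<cdot> q \<and>
    (\<forall>Y. \<forall>a \<in> hom C Y (Dom C f). \<forall>b \<in> hom C Y (Dom C g). f \<cdot> a = g \<cdot> b \<longrightarrow>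
      (\<exists>!h. h \<in> hom C Y (Dom C p) \<and> p \<cdot> h = a \<and> q \<cdot> h = b))"

definition is_kernel_pair :: "'m \<Rightarrow> 'm \<Rightarrow> 'm \<Rightarrow> bool" where
  "is_kernel_pair f p q \<longleftrightarrow> is_pullback f f p q"

definition is_kernel :: "'m \<Rightarrow> 'm \<Rightarrow> bool" where
  "is_kernel f k \<longleftrightarrow>
    f \<in> Arr C \<and> k \<in> hom C (Dom C k) (Dom C f) \<and> f \<cdot> k = zero (Dom C k) (Cod C f) \<and>
    (\<forall>Y. \<forall>a \<in> hom C Y (Dom C f). f \<cdot> a = zero Y (Cod C f) \<longrightarrow>
      (\<exists>!h. h \<in> hom C Y (Dom C k) \<and> k \<cdot> h = a))"

definition is_coequaliser :: "'m \<Rightarrow> 'm \<Rightarrow> 'm \<Rightarrow> bool" where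
  "is_coequaliser f g q \<longleftrightarrow>
    f \<in> Arr C \<and> g \<in> hom C (Dom C f) (Cod C f) \<and> q \<in> hom C (Cod C f) (Cod C q) \<and>
    q \<cdot> f = q \<cdot> g \<and>
    (\<forall>Y. \<forall>a \<in> hom C (Cod C f) Y. a \<cdot> f = a \<cdot> g \<longrightarrow>
      (\<exists>!h. h \<in> hom C (Cod C q) Y \<and> h \<cdot> q = a))"

definition has_binary_coproducts :: bool where
  "has_binary_coproducts \<longleftrightarrow> (\<forall>A \<in> Obj C. \<forall>B \<in> Obj C. \<exists>i j. is_coproduct A B i j)"

text \<open>Finite completeness, as existence of a terminal object and of all pullbacks.\<close>

definition finitely_complete :: bool where
  "finitely_complete \<longleftrightarrow> (\<exists>T. is_terminal T) \<and>
    (\<forall>f \<in> Arr C. \<forall>g \<in> Arr C. Cod C f = Cod C g \<longrightarrow> (\<exists>p q. is_pullback f g p q))"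


subsection \<open>Barr exactness and Bourn protomodularity\<close>

definition regular_epi :: "'m \<Rightarrow> bool" where
  "regular_epi e \<longleftrightarrow> (\<exists>f g. is_coequaliser f g e)"

definition regular_category :: bool where
  "regular_category \<longleftrightarrow> finitely_complete \<and>
    (\<forall>f p q. is_kernel_pair f p q \<longrightarrow> (\<exists>e. is_coequaliser p q e)) \<and>
    (\<forall>f e p q. is_pullback f e p q \<and> regular_epi e \<longrightarrow> regular_epi p)"

definition equivalence_relation :: "'o \<Rightarrow> 'm \<Rightarrow> 'm \<Rightarrow> bool" where
  "equivalence_relation X r1 r2 \<longleftrightarrow>
    r1 \<in> hom C (Dom C r1) X \<and> r2 \<in> hom C (Dom C r1) X \<and>
    (\<forall>Y. \<forall>a \<in> hom C Y (Dom C r1). \<forall>b \<in> hom C Y (Dom C r1).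
      r1 \<cdot> a = r1 \<cdot> b \<and> r2 \<cdot> a = r2 \<cdot> b \<longrightarrow> a = b) \<and>
    (\<exists>d \<in> hom C X (Dom C r1). r1 \<cdot> d = Id C X \<and> r2 \<cdot> d = Id C X) \<and>
    (\<exists>s \<in> hom C (Dom C r1) (Dom C r1). r1 \<cdot> s = r2 \<and> r2 \<cdot> s = r1) \<and>
    (\<forall>p q. is_pullback r2 r1 p q \<longrightarrow>
      (\<exists>t \<in> hom C (Dom C p) (Dom C r1). r1 \<cdot> t = r1 \<cdot> p \<and> r2 \<cdot> t = r2 \<cdot> q))"

definition barr_exact :: bool where
  "barr_exact \<longleftrightarrow> regular_category \<and>
    (\<forall>X r1 r2. equivalence_relation X r1 r2 \<longrightarrow> (\<exists>f. is_kernel_pair f r1 r2))"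

definition is_point :: "'o \<Rightarrow> 'm \<Rightarrow> 'm \<Rightarrow> bool" where
  "is_point B f s \<longleftrightarrow> f \<in> hom C (Dom C f) B \<and> s \<in> hom C B (Dom C f) \<and> f \<cdot> s = Id C B"

text \<open>For every \<open>p : E \<rightarrow> B\<close> the change-of-base functor from points over \<open>B\<close> to points over \<open>E\<close>
  reflects isomorphisms; \<open>b\<close> below is the image of the morphism of points \<open>a\<close>.\<close>

definition protomodular :: bool where
  "protomodular \<longleftrightarrow> (\<forall>E B p f s f' s' a u v u' v' b.
    p \<in> hom C E B \<and> is_point B f s \<and> is_point B f' s' \<and>
    a \<in> hom C (Dom C f) (Dom C f') \<and> f' \<cdot> a = f \<and> a \<cdot> s = s' \<and>
    is_pullback f p u v \<and> is_pullback f' p u' v' \<and>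
    b \<in> hom C (Dom C u) (Dom C u') \<and> u' \<cdot> b = a \<cdot> u \<and> v' \<cdot> b = v \<and>
    iso b \<longrightarrow> iso a)"


subsection \<open>Chosen coproducts, products and kernels\<close>

definition inl :: "'o \<Rightarrow> 'o \<Rightarrow> 'm" where
  "inl A B = fst (SOME ij. is_coproduct A B (fst ij) (snd ij))"

definition inr :: "'o \<Rightarrow> 'o \<Rightarrow> 'm" where
  "inr A B = snd (SOME ij. is_coproduct A B (fst ij) (snd ij))"

definition cop :: "'o \<Rightarrow> 'o \<Rightarrow> 'o" (infixl "\<amalg>" 65) where
  "A \<amalg> B = Cod C (inl A B)"

definition copair :: "'m \<Rightarrow> 'm \<Rightarrow> 'm" where
  "copair f g = (THE h. h \<in> hom C (Dom C f \<amalg> Dom C g) (Cod C f) \<and>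
    h \<cdot> inl (Dom C f) (Dom C g) = f \<and> h \<cdot> inr (Dom C f) (Dom C g) = g)"

definition cosum :: "'m \<Rightarrow> 'm \<Rightarrow> 'm" where
  "cosum f g = copair (inl (Cod C f) (Cod C g) \<cdot> f) (inr (Cod C f) (Cod C g) \<cdot> g)"

text \<open>The canonical isomorphism from \<open>A \<amalg> B\<close> to \<open>B \<amalg> A\<close>. The chosen coproduct is not strictly
  symmetric, so the usual tacit identification of these two objects is made through this map.\<close>

definition twist :: "'o \<Rightarrow> 'o \<Rightarrow> 'm" where
  "twist A B = copair (inr B A) (inl B A)"

definition proj1 :: "'o \<Rightarrow> 'o \<Rightarrow> 'm" where
  "proj1 A B = fst (SOME pq. is_product A B (fst pq) (snd pq))"

definition proj2 :: "'o \<Rightarrow> 'o \<Rightarrow> 'm" where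
  "proj2 A B = snd (SOME pq. is_product A B (fst pq) (snd pq))"

definition prd :: "'o \<Rightarrow> 'o \<Rightarrow> 'o" where
  "prd A B = Dom C (proj1 A B)"

definition pair :: "'m \<Rightarrow> 'm \<Rightarrow> 'm" where
  "pair f g = (THE h. h \<in> hom C (Dom C f) (prd (Cod C f) (Cod C g)) \<and>
    proj1 (Cod C f) (Cod C g) \<cdot> h = f \<and> proj2 (Cod C f) (Cod C g) \<cdot> h = g)"

definition ker :: "'m \<Rightarrow> 'm" where
  "ker f = (SOME k. is_kernel f k)"

text \<open>The factorisation of \<open>f\<close> through a monomorphism \<open>k\<close>.\<close>

definition factor :: "'m \<Rightarrow> 'm \<Rightarrow> 'm" where
  "factor k f = (THE u. u \<in> hom C (Dom C f) (Dom C k) \<and> k \<cdot> u = f)"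


subsection \<open>The Smith is Huq condition\<close>

definition huq_commute :: "'m \<Rightarrow> 'm \<Rightarrow> bool" where
  "huq_commute m n \<longleftrightarrow> (\<exists>\<phi> \<in> hom C (prd (Dom C m) (Dom C n)) (Cod C m).
    \<phi> \<cdot> pair (Id C (Dom C m)) (zero (Dom C m) (Dom C n)) = m \<and>
    \<phi> \<cdot> pair (zero (Dom C n) (Dom C m)) (Id C (Dom C n)) = n)"

text \<open>Existence of a partial Maltsev operation \<open>\<theta>\<close> on the object of triples \<open>x R y S z\<close> (the
  pullback of \<open>r2\<close> and \<open>s1\<close>) with \<open>\<theta>(x, y, y) = x\<close> and \<open>\<theta>(y, y, z) = z\<close>. Here \<open>l\<close> is
  \<open>(x, y) \<mapsto> (x, y, y)\<close> and \<open>l'\<close> is \<open>(y, z) \<mapsto> (y, y, z)\<close>. In a Maltsev category, hence in a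
  semi-abelian one, such a \<open>\<theta>\<close> is automatically a connector.\<close>

definition smith_centralise :: "'o \<Rightarrow> 'm \<Rightarrow> 'm \<Rightarrow> 'm \<Rightarrow> 'm \<Rightarrow> bool" where
  "smith_centralise X r1 r2 s1 s2 \<longleftrightarrow> (\<exists>p q \<theta> l l'.
    is_pullback r2 s1 p q \<and> \<theta> \<in> hom C (Dom C p) X \<and>
    l \<in> hom C (Dom C r1) (Dom C p) \<and>
    p \<cdot> l = Id C (Dom C r1) \<and> s1 \<cdot> (q \<cdot> l) = r2 \<and> s2 \<cdot> (q \<cdot> l) = r2 \<and>
    l' \<in> hom C (Dom C s1) (Dom C p) \<and>
    q \<cdot> l' = Id C (Dom C s1) \<and> r1 \<cdot> (p \<cdot> l') = s1 \<and> r2 \<cdot> (p \<cdot> l') = s1 \<and>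
    \<theta> \<cdot> l = r1 \<and> \<theta> \<cdot> l' = s2)"

definition normalisation :: "'m \<Rightarrow> 'm \<Rightarrow> 'm" where
  "normalisation r1 r2 = r2 \<cdot> ker r1"

definition smith_is_huq :: bool where
  "smith_is_huq \<longleftrightarrow> (\<forall>X r1 r2 s1 s2.
    equivalence_relation X r1 r2 \<and> equivalence_relation X s1 s2 \<and>
    huq_commute (normalisation r1 r2) (normalisation s1 s2) \<longrightarrow>
    smith_centralise X r1 r2 s1 s2)"


subsection \<open>Internal actions\<close>

definition kflat :: "'o \<Rightarrow> 'o \<Rightarrow> 'm" where
  "kflat A B = ker (copair (Id C A) (zero B A))"

definition flat :: "'o \<Rightarrow> 'o \<Rightarrow> 'o" (infixl "\<flat>" 68) where
  "A \<flat> B = Dom C (kflat A B)"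

definition flat_map :: "'m \<Rightarrow> 'm \<Rightarrow> 'm" where
  "flat_map f g =
    factor (kflat (Cod C f) (Cod C g)) (cosum f g \<cdot> kflat (Dom C f) (Dom C g))"

definition flat_unit :: "'o \<Rightarrow> 'o \<Rightarrow> 'm" where
  "flat_unit A B = factor (kflat A B) (inr A B)"

definition flat_mult :: "'o \<Rightarrow> 'o \<Rightarrow> 'm" where
  "flat_mult A B = factor (kflat A B) (copair (inl A B) (kflat A B) \<cdot> kflat A (A \<flat> B))"

definition internal_action :: "'o \<Rightarrow> 'o \<Rightarrow> 'm \<Rightarrow> bool" where
  "internal_action A X \<xi> \<longleftrightarrow> \<xi> \<in> hom C (A \<flat> X) X \<and>
    \<xi> \<cdot> flat_unit A X = Id C X \<and>
    \<xi> \<cdot> flat_mult A X = \<xi> \<cdot> flat_map (Id C A) \<xi>"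

definition conjugation :: "'o \<Rightarrow> 'm" where
  "conjugation A = copair (Id C A) (Id C A) \<cdot> kflat A A"


subsection \<open>Cosmash products\<close>

definition h2 :: "'o \<Rightarrow> 'o \<Rightarrow> 'm" where
  "h2 A B = ker (pair (copair (Id C A) (zero B A)) (copair (zero A B) (Id C B)))"

definition i_cosmash :: "'o \<Rightarrow> 'o \<Rightarrow> 'm" where
  "i_cosmash A B = factor (kflat A B) (h2 A B)"

definition h3 :: "'o \<Rightarrow> 'o \<Rightarrow> 'o \<Rightarrow> 'm" where
  "h3 A B D = ker (pair
    (pair
      (copair (copair (inl A B) (inr A B)) (zero D (A \<amalg> B)))
      (copair (copair (inl A D) (zero B (A \<amalg> D))) (inr A D)))
    (copair (copair (zero A (B \<amalg> D)) (inl B D)) (inr B D)))"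

definition j3 :: "'o \<Rightarrow> 'o \<Rightarrow> 'o \<Rightarrow> 'm" where
  "j3 A B D = factor (kflat (A \<amalg> B) D) (h3 A B D)"

text \<open>The folding morphisms \<open>M \<diamond> N \<diamond> M \<rightarrow> N \<diamond> M\<close> and \<open>M \<diamond> N \<diamond> N \<rightarrow> M \<diamond> N\<close>.\<close>

definition fold_outer :: "'o \<Rightarrow> 'o \<Rightarrow> 'm" where
  "fold_outer N M = factor (h2 N M) (copair (copair (inr N M) (inl N M)) (inr N M) \<cdot> h3 M N M)"

definition fold_right :: "'o \<Rightarrow> 'o \<Rightarrow> 'm" where
  "fold_right M N = factor (h2 M N) (copair (copair (inl M N) (inr M N)) (inr M N) \<cdot> h3 M N N)"


subsection \<open>Compatible actions and Peiffer products\<close>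

text \<open>Throughout, \<open>\<xi>N : M \<flat> N \<rightarrow> N\<close>, \<open>\<xi>M : N \<flat> M \<rightarrow> M\<close>, \<open>\<zeta>M : (M \<amalg> N) \<flat> M \<rightarrow> M\<close> and
  \<open>\<zeta>N : (M \<amalg> N) \<flat> N \<rightarrow> N\<close>.\<close>

definition peiffer_inclusion :: "'o \<Rightarrow> 'o \<Rightarrow> 'm" where
  "peiffer_inclusion M N = copair (twist N M \<cdot> kflat N M) (kflat M N)"

definition coproduct_actions :: "'o \<Rightarrow> 'o \<Rightarrow> 'm \<Rightarrow> 'm \<Rightarrow> 'm \<Rightarrow> 'm \<Rightarrow> bool" where
  "coproduct_actions M N \<xi>N \<xi>M \<zeta>M \<zeta>N \<longleftrightarrow>
    internal_action (M \<amalg> N) M \<zeta>M \<and> internal_action (M \<amalg> N) N \<zeta>N \<and>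
    \<zeta>M \<cdot> flat_map (inr M N) (Id C M) = \<xi>M \<and>
    \<zeta>M \<cdot> flat_map (inl M N) (Id C M) = conjugation M \<and>
    \<zeta>M \<cdot> j3 M N M = \<xi>M \<cdot> i_cosmash N M \<cdot> fold_outer N M \<and>
    \<zeta>N \<cdot> flat_map (inl M N) (Id C N) = \<xi>N \<and>
    \<zeta>N \<cdot> flat_map (inr M N) (Id C N) = conjugation N \<and>
    \<zeta>N \<cdot> j3 M N N = \<xi>N \<cdot> i_cosmash M N \<cdot> fold_right M N \<and>
    \<zeta>M \<cdot> flat_map (cosum \<xi>M \<xi>N) (Id C M) = \<zeta>M \<cdot> flat_map (peiffer_inclusion M N) (Id C M) \<and>
    \<zeta>N \<cdot> flat_map (cosum \<xi>M \<xi>N) (Id C N) = \<zeta>N \<cdot> flat_map (peiffer_inclusion M N) (Id C N)"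

definition compatible_actions :: "'o \<Rightarrow> 'o \<Rightarrow> 'm \<Rightarrow> 'm \<Rightarrow> bool" where
  "compatible_actions M N \<xi>N \<xi>M \<longleftrightarrow> (\<exists>\<zeta>M \<zeta>N. coproduct_actions M N \<xi>N \<xi>M \<zeta>M \<zeta>N)"

text \<open>The next two predicates say that \<open>P\<close> is a Peiffer product, respectively a strong one, that is
  the codomain of some coequaliser of the relevant pair. The actions \<open>\<zeta>M\<close>, \<open>\<zeta>N\<close> are uniquely
  determined in a semi-abelian category.\<close>

definition is_peiffer_product :: "'o \<Rightarrow> 'o \<Rightarrow> 'm \<Rightarrow> 'm \<Rightarrow> 'o \<Rightarrow> bool" where
  "is_peiffer_product M N \<xi>N \<xi>M P \<longleftrightarrow>
    (\<exists>q \<in> hom C (M \<amalg> N) P. is_coequaliser (peiffer_inclusion M N) (cosum \<xi>M \<xi>N) q)"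

definition is_strong_peiffer_product :: "'o \<Rightarrow> 'o \<Rightarrow> 'm \<Rightarrow> 'm \<Rightarrow> 'o \<Rightarrow> bool" where
  "is_strong_peiffer_product M N \<xi>N \<xi>M P \<longleftrightarrow>
    (\<exists>\<zeta>M \<zeta>N. coproduct_actions M N \<xi>N \<xi>M \<zeta>M \<zeta>N \<and>
      (\<exists>q \<in> hom C (M \<amalg> N) P. is_coequaliser
        (conjugation (M \<amalg> N) \<cdot>
          copair (flat_map (Id C (M \<amalg> N)) (inl M N)) (flat_map (Id C (M \<amalg> N)) (inr M N)))
        (cosum \<zeta>M \<zeta>N) q))"

end

locale semi_abelian_category = category +
  assumes pointed: pointed
    and barr_exact: barr_exact
    and protomodular: protomodular
    and has_binary_coproducts: has_binary_coproducts

end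

theory Submission
  imports Defs
begin

text \<open>The morphisms \<open>A \<flat> D \<rightarrow> (A \<amalg> B) \<flat> D\<close>, \<open>B \<flat> D \<rightarrow> (A \<amalg> B) \<flat> D\<close> and
  \<open>A \<diamond> B \<diamond> D \<rightarrow> (A \<amalg> B) \<flat> D\<close> are jointly epic, by protomodularity. Condition (CA.0) describes
  the actions of \<open>M \<amalg> N\<close> on these three pieces, and there the identity imposed by the strong Peiffer
  product is respectively trivial (conjugation), the identity imposed by the Peiffer product, and a
  consequence of the latter through the folding morphism. Conversely, the Peiffer identities are
  restrictions of the strong ones along \<open>M \<rightarrow> M \<amalg> N\<close> and \<open>N \<rightarrow> M \<amalg> N\<close>. Hence a morphism coequalises
  one pair exactly when it coequalises the other.\<close>

subsection \<open>General categories\<close>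

context category
begin

section \<open>Composition and typing in a category\<close>

lemma homI: "f \<in> Arr C \<Longrightarrow> Dom C f = A \<Longrightarrow> Cod C f = B \<Longrightarrow> f \<in> hom C A B"
  by (simp add: hom_def)

lemma homD:
  assumes "f \<in> hom C A B"
  shows "f \<in> Arr C" "Dom C f = A" "Cod C f = B" "A \<in> Obj C" "B \<in> Obj C"
  using assms Dom_in_Obj Cod_in_Obj by (auto simp: hom_def)

lemma Comp_simps [simp]:
  assumes "f \<in> Arr C" "g \<in> Arr C" "Cod C f = Dom C g"
  shows "g \<cdot> f \<in> Arr C" "Dom C (g \<cdot> f) = Dom C f" "Cod C (g \<cdot> f) = Cod C g"
  using Comp_in_hom[of f "Dom C f" "Dom C g" g "Cod C g"] assms by (auto simp: hom_def)

lemma Comp_assoc' [simp]: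
  assumes "f \<in> Arr C" "g \<in> Arr C" "h \<in> Arr C" "Cod C f = Dom C g" "Cod C g = Dom C h"
  shows "h \<cdot> g \<cdot> f = h \<cdot> (g \<cdot> f)"
  using Comp_assoc[of f "Dom C f" "Dom C g" g "Dom C h" h "Cod C h"] assms
  by (auto simp: hom_def)

text \<open>\<open>Comp_assoc'\<close> normalises composites to right-nested form, where
  \<open>g \<cdot> f\<close> no longer occurs as a subterm once something is composed on the right.
  This form lets an equation for \<open>g \<cdot> f\<close> rewrite inside a longer chain.\<close>

lemma reassoc:
  assumes "g \<cdot> f = h" "x \<in> Arr C" "f \<in> Arr C" "g \<in> Arr C" "Cod C x = Dom C f" "Cod C f = Dom C g"
  shows "g \<cdot> (f \<cdot> x) = h \<cdot> x"
  using Comp_assoc'[of x f g] assms by simp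

lemma Obj_simps [simp]: "f \<in> Arr C \<Longrightarrow> Dom C f \<in> Obj C" "f \<in> Arr C \<Longrightarrow> Cod C f \<in> Obj C"
  by (simp_all add: Dom_in_Obj Cod_in_Obj)

lemma Id_simps [simp]:
  assumes "A \<in> Obj C"
  shows "Id C A \<in> Arr C" "Dom C (Id C A) = A" "Cod C (Id C A) = A"
  using Id_in_hom[OF assms] by (auto simp: hom_def)

lemma Comp_Id' [simp]: "f \<in> Arr C \<Longrightarrow> Dom C f = A \<Longrightarrow> f \<cdot> Id C A = f"
  and Id_Comp' [simp]: "f \<in> Arr C \<Longrightarrow> Cod C f = A \<Longrightarrow> Id C A \<cdot> f = f"
  using Comp_Id Id_Comp by (auto simp: hom_def)

lemma isoI:
  assumes "f \<in> hom C A B" "g \<in> hom C B A" "g \<cdot> f = Id C A" "f \<cdot> g = Id C B"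
  shows "iso f"
  using assms unfolding iso_def by (auto simp: hom_def)

lemma iso_Id: "A \<in> Obj C \<Longrightarrow> iso (Id C A)"
  by (rule isoI[of _ A A "Id C A"]) (simp_all add: homI)

lemma is_pullbackD:
  assumes "is_pullback f g p q"
  shows "p \<in> hom C (Dom C p) (Dom C f)" "q \<in> hom C (Dom C p) (Dom C g)" "f \<cdot> p = g \<cdot> q"
  using assms unfolding is_pullback_def by - (elim conjE, assumption)+

lemma is_pullback_ex1:
  assumes "is_pullback f g p q" "a \<in> hom C Y (Dom C f)" "b \<in> hom C Y (Dom C g)" "f \<cdot> a = g \<cdot> b"
  shows "\<exists>!h. h \<in> hom C Y (Dom C p) \<and> p \<cdot> h = a \<and> q \<cdot> h = b"
proof -
  have "\<forall>Y. \<forall>a \<in> hom C Y (Dom C f). \<forall>b \<in> hom C Y (Dom C g). f \<cdot> a = g \<cdot> b \<longrightarrow>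
      (\<exists>!h. h \<in> hom C Y (Dom C p) \<and> p \<cdot> h = a \<and> q \<cdot> h = b)"
    using assms(1) unfolding is_pullback_def by (elim conjE)
  from this[rule_format, OF assms(2-4)] show ?thesis .
qed

lemma is_coequaliserD:
  assumes "is_coequaliser f g q"
  shows "f \<in> Arr C" "g \<in> hom C (Dom C f) (Cod C f)" "q \<in> hom C (Cod C f) (Cod C q)" "q \<cdot> f = q \<cdot> g"
  using assms unfolding is_coequaliser_def by - (elim conjE, assumption)+

lemma is_coequaliser_ex1:
  assumes "is_coequaliser f g q" "a \<in> hom C (Cod C f) Y" "a \<cdot> f = a \<cdot> g"
  shows "\<exists>!h. h \<in> hom C (Cod C q) Y \<and> h \<cdot> q = a"
proof -
  have "\<forall>Y. \<forall>a \<in> hom C (Cod C f) Y. a \<cdot> f = a \<cdot> g \<longrightarrow> (\<exists>!h. h \<in> hom C (Cod C q) Y \<and> h \<cdot> q = a)"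
    using assms(1) unfolding is_coequaliser_def by (elim conjE)
  from this[rule_format, OF assms(2-3)] show ?thesis .
qed

section \<open>Zero objects and coequalisers\<close>

lemma zero_objectD:
  assumes Z: "is_zero_object Z"
  shows zero_object_Obj: "Z \<in> Obj C"
    and zero_object_to: "A \<in> Obj C \<Longrightarrow> \<exists>f. f \<in> hom C A Z"
    and zero_object_from: "A \<in> Obj C \<Longrightarrow> \<exists>f. f \<in> hom C Z A"
    and zero_object_to_unique: "a \<in> hom C A Z \<Longrightarrow> b \<in> hom C A Z \<Longrightarrow> a = b"
    and zero_object_from_unique: "a \<in> hom C Z A \<Longrightarrow> b \<in> hom C Z A \<Longrightarrow> a = b"
proof -
  show "Z \<in> Obj C" using Z by (simp add: is_zero_object_def is_initial_def)
  have t: "\<exists>!f. f \<in> hom C A Z" and i: "\<exists>!f. f \<in> hom C Z A" if "A \<in> Obj C" for A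
    using Z that by (simp_all add: is_zero_object_def is_initial_def is_terminal_def)
  show "\<exists>f. f \<in> hom C A Z" "\<exists>f. f \<in> hom C Z A" if "A \<in> Obj C" using t[OF that] i[OF that] by auto
  show "a = b" if "a \<in> hom C A Z" "b \<in> hom C A Z"
    using t[OF homD(4)[OF that(1)]] that by auto
  show "a = b" if "a \<in> hom C Z A" "b \<in> hom C Z A"
    using i[OF homD(5)[OF that(1)]] that by auto
qed

lemma coequaliser_epi:
  assumes "is_coequaliser f g q" "a \<in> hom C (Cod C q) Y" "b \<in> hom C (Cod C q) Y" "a \<cdot> q = b \<cdot> q"
  shows "a = b"
proof -
  note D = is_coequaliserD[OF assms(1)]
  note arr = D(1) homD[OF D(2)] homD[OF D(3)] homD[OF assms(3)]
  have "b \<cdot> q \<in> hom C (Cod C f) Y" using arr by (simp add: homI)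
  moreover have "b \<cdot> q \<cdot> f = b \<cdot> q \<cdot> g" using arr D(4) by simp
  ultimately have "\<exists>!h. h \<in> hom C (Cod C q) Y \<and> h \<cdot> q = b \<cdot> q"
    by (rule is_coequaliser_ex1[OF assms(1)])
  with assms(2-4) show ?thesis by metis
qed

text \<open>Each quotient map coequalises the pair of the other, so each factors through the other,
  and the factorisations are mutually inverse because coequalisers are epic. Only the codomains of
  the two pairs have to agree, as for the two Peiffer products.\<close>

lemma coequaliser_isomorphic:
  assumes q: "is_coequaliser f g q" and q': "is_coequaliser f' g' q'"
    and cod: "Cod C f' = Cod C f"
    and eq: "q \<cdot> f' = q \<cdot> g'" and eq': "q' \<cdot> f = q' \<cdot> g"
  shows "isomorphic (Cod C q) (Cod C q')"
proof -
  note h = is_coequaliserD(3)[OF q] is_coequaliserD(3)[OF q', unfolded cod]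
  note arr = homD[OF h(1)] homD[OF h(2)]
  obtain u where u: "u \<in> hom C (Cod C q) (Cod C q')" "u \<cdot> q = q'"
    using is_coequaliser_ex1[OF q h(2) eq'] by metis
  obtain v where v: "v \<in> hom C (Cod C q') (Cod C q)" "v \<cdot> q' = q"
    using is_coequaliser_ex1[OF q', unfolded cod, OF h(1) eq] by metis
  note uv = homD[OF u(1)] homD[OF v(1)]
  have 1: "v \<cdot> u = Id C (Cod C q)"
    by (rule coequaliser_epi[OF q, of _ "Cod C q"]) (use u(2) v(2) uv arr in \<open>auto intro!: homI\<close>)
  have 2: "u \<cdot> v = Id C (Cod C q')"
    by (rule coequaliser_epi[OF q', of _ "Cod C q'"]) (use u(2) v(2) uv arr in \<open>auto intro!: homI\<close>)
  show ?thesis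
    unfolding isomorphic_def using isoI[OF u(1) v(1) 1 2] u(1) by (rule bexI)
qed

end

subsection \<open>Limits and coproducts\<close>

context semi_abelian_category
begin

lemma finite_limits: finitely_complete
  using barr_exact unfolding barr_exact_def regular_category_def by blast

lemma pullback_exists:
  assumes "f \<in> Arr C" "g \<in> Arr C" "Cod C f = Cod C g"
  obtains p q where "is_pullback f g p q"
  using finite_limits assms unfolding finitely_complete_def by blast

section \<open>Zero morphisms\<close>

lemma zero_eq:
  assumes Z: "is_zero_object Z" and u: "u \<in> hom C A Z" and v: "v \<in> hom C Z B"
  shows "zero A B = v \<cdot> u"
  unfolding zero_def
proof (rule the_equality)
  show "\<exists>Z' u' v'. is_zero_object Z' \<and> u' \<in> hom C A Z' \<and> v' \<in> hom C Z' B \<and> v \<cdot> u = v' \<cdot> u'"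
    using assms by blast
  fix f assume "\<exists>Z' u' v'. is_zero_object Z' \<and> u' \<in> hom C A Z' \<and> v' \<in> hom C Z' B \<and> f = v' \<cdot> u'"
  then obtain Z' u' v' where Z': "is_zero_object Z'" "u' \<in> hom C A Z'" "v' \<in> hom C Z' B"
    and f: "f = v' \<cdot> u'" by blast
  \<comment> \<open>\<open>t\<close> compares the two zero objects. Uniqueness of maps into one and
    out of the other shows that the composite does not depend on the zero object, as the definite
    description in \<open>zero\<close> requires.\<close>
  obtain t where t: "t \<in> hom C Z Z'"
    using zero_object_to[OF Z'(1) zero_object_Obj[OF Z]] by blast
  have "t \<cdot> u = u'"
    by (rule zero_object_to_unique[OF Z'(1) Comp_in_hom[OF u t] Z'(2)])
  moreover have "v' \<cdot> t = v"
    by (rule zero_object_from_unique[OF Z Comp_in_hom[OF t Z'(3)] v])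
  ultimately show "f = v \<cdot> u"
    using f Comp_assoc[OF u t Z'(3)] by simp
qed

lemma zero_factors:
  assumes "A \<in> Obj C" "B \<in> Obj C" "is_zero_object Z"
  obtains u v where "u \<in> hom C A Z" "v \<in> hom C Z B" "zero A B = v \<cdot> u"
  using zero_object_to[OF assms(3,1)] zero_object_from[OF assms(3,2)] zero_eq[OF assms(3)] by blast

lemma zero_simps [simp]:
  assumes "A \<in> Obj C" "B \<in> Obj C"
  shows "zero A B \<in> Arr C" "Dom C (zero A B) = A" "Cod C (zero A B) = B"
proof -
  obtain Z where Z: "is_zero_object Z" using pointed unfolding pointed_def by blast
  have "zero A B \<in> hom C A B" using zero_factors[OF assms Z] Comp_in_hom by metis
  then show "zero A B \<in> Arr C" "Dom C (zero A B) = A" "Cod C (zero A B) = B"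
    by (auto simp: hom_def)
qed

lemma Comp_zero [simp]:
  assumes f: "f \<in> Arr C" "Dom C f = B" and A: "A \<in> Obj C"
  shows "f \<cdot> zero A B = zero A (Cod C f)"
proof -
  obtain Z where Z: "is_zero_object Z" using pointed unfolding pointed_def by blast
  obtain u v where uv: "u \<in> hom C A Z" "v \<in> hom C Z B" "zero A B = v \<cdot> u"
    using zero_factors[OF A _ Z] f by (metis Obj_simps(1))
  have "f \<cdot> v \<in> hom C Z (Cod C f)" using Comp_in_hom[OF uv(2)] f by (simp add: homI)
  from zero_eq[OF Z uv(1) this] show ?thesis
    using uv f homD[OF uv(1)] homD[OF uv(2)] by simp
qed

lemma zero_Comp [simp]:
  assumes f: "f \<in> Arr C" "Cod C f = A" and B: "B \<in> Obj C"
  shows "zero A B \<cdot> f = zero (Dom C f) B"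
proof -
  obtain Z where Z: "is_zero_object Z" using pointed unfolding pointed_def by blast
  obtain u v where uv: "u \<in> hom C A Z" "v \<in> hom C Z B" "zero A B = v \<cdot> u"
    using zero_factors[OF _ B Z] f by (metis Obj_simps(2))
  have "u \<cdot> f \<in> hom C (Dom C f) Z" using Comp_in_hom[OF _ uv(1)] f by (simp add: homI)
  from zero_eq[OF Z this uv(2)] show ?thesis
    using uv f homD[OF uv(1)] homD[OF uv(2)] by simp
qed

section \<open>Chosen coproducts and copairings\<close>

lemma coproduct_exists:
  assumes "A \<in> Obj C" "B \<in> Obj C"
  shows "is_coproduct A B (inl A B) (inr A B)"
  using someI_ex[of "\<lambda>ij. is_coproduct A B (fst ij) (snd ij)"] assms has_binary_coproducts
  unfolding has_binary_coproducts_def inl_def inr_def by auto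

lemma inl_inr_simps [simp]:
  assumes "A \<in> Obj C" "B \<in> Obj C"
  shows "inl A B \<in> Arr C" "Dom C (inl A B) = A" "Cod C (inl A B) = A \<amalg> B"
    "inr A B \<in> Arr C" "Dom C (inr A B) = B" "Cod C (inr A B) = A \<amalg> B"
  using coproduct_exists[OF assms] unfolding is_coproduct_def hom_def cop_def by auto

lemma cop_Obj [simp]: "A \<in> Obj C \<Longrightarrow> B \<in> Obj C \<Longrightarrow> A \<amalg> B \<in> Obj C"
  by (metis inl_inr_simps(1,3) Obj_simps(2))

lemma cop_ext:
  assumes "A \<in> Obj C" "B \<in> Obj C" and f: "f \<in> hom C (A \<amalg> B) Y" and g: "g \<in> hom C (A \<amalg> B) Y"
    and "f \<cdot> inl A B = g \<cdot> inl A B" "f \<cdot> inr A B = g \<cdot> inr A B"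
  shows "f = g"
proof -
  have "g \<cdot> inl A B \<in> hom C A Y" "g \<cdot> inr A B \<in> hom C B Y"
    using homD[OF g] assms(1,2) by (simp_all add: homI)
  then have "\<exists>!h. h \<in> hom C (A \<amalg> B) Y \<and> h \<cdot> inl A B = g \<cdot> inl A B \<and> h \<cdot> inr A B = g \<cdot> inr A B"
    using coproduct_exists[OF assms(1,2)] unfolding is_coproduct_def cop_def by blast
  then show ?thesis using f g assms(5,6) by blast
qed

lemma copair_char:
  assumes "f \<in> Arr C" "g \<in> Arr C" "Cod C f = Cod C g"
  shows "copair f g \<in> hom C (Dom C f \<amalg> Dom C g) (Cod C f) \<and>
    copair f g \<cdot> inl (Dom C f) (Dom C g) = f \<and> copair f g \<cdot> inr (Dom C f) (Dom C g) = g"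
  unfolding copair_def
proof (rule theI')
  have "f \<in> hom C (Dom C f) (Cod C f)" "g \<in> hom C (Dom C g) (Cod C f)"
    using assms by (auto simp: hom_def)
  then show "\<exists>!h. h \<in> hom C (Dom C f \<amalg> Dom C g) (Cod C f) \<and>
    h \<cdot> inl (Dom C f) (Dom C g) = f \<and> h \<cdot> inr (Dom C f) (Dom C g) = g"
    using coproduct_exists[of "Dom C f" "Dom C g"] assms
    unfolding is_coproduct_def cop_def by simp
qed

lemma copair_simps [simp]:
  assumes "f \<in> Arr C" "g \<in> Arr C" "Cod C f = Cod C g"
  shows "copair f g \<in> Arr C" "Dom C (copair f g) = Dom C f \<amalg> Dom C g"
    "Cod C (copair f g) = Cod C g"
  using copair_char[OF assms] assms(3) by (auto simp: hom_def)

lemma copair_inl [simp]: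
  assumes "f \<in> Arr C" "g \<in> Arr C" "Cod C f = Cod C g" "Dom C f = A" "Dom C g = B"
  shows "copair f g \<cdot> inl A B = f"
  and copair_inr [simp]: "copair f g \<cdot> inr A B = g"
  using copair_char[OF assms(1-3)] assms(4,5) by auto

lemma copair_inl_Comp [simp]:
  assumes "f \<in> Arr C" "g \<in> Arr C" "Cod C f = Cod C g" "Dom C f = A" "Dom C g = B"
    "x \<in> Arr C"
  shows "Cod C x = A \<Longrightarrow> copair f g \<cdot> (inl A B \<cdot> x) = f \<cdot> x"
  and copair_inr_Comp [simp]: "Cod C x = B \<Longrightarrow> copair f g \<cdot> (inr A B \<cdot> x) = g \<cdot> x"
proof -
  have AB: "A \<in> Obj C" "B \<in> Obj C" using assms by auto
  show "copair f g \<cdot> (inl A B \<cdot> x) = f \<cdot> x" if "Cod C x = A"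
    using Comp_assoc'[of x "inl A B" "copair f g"] assms AB that by simp
  show "copair f g \<cdot> (inr A B \<cdot> x) = g \<cdot> x" if "Cod C x = B"
    using Comp_assoc'[of x "inr A B" "copair f g"] assms AB that by simp
qed

text \<open>As a simplification rule it pushes composition inside copairings. Together with the
  rules for \<open>inl\<close> and \<open>inr\<close>, it reduces equations between maps out of
  iterated coproducts to their components.\<close>

lemma Comp_copair [simp]:
  assumes "f \<in> Arr C" "g \<in> Arr C" "Cod C f = Cod C g" "h \<in> Arr C" "Dom C h = Cod C g"
  shows "h \<cdot> copair f g = copair (h \<cdot> f) (h \<cdot> g)"
  by (rule cop_ext[of "Dom C f" "Dom C g" _ "Cod C h"]) (use assms in \<open>auto intro!: homI\<close>)

lemma Comp_copair_Comp [simp]: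
  assumes "f \<in> Arr C" "g \<in> Arr C" "Cod C f = Cod C g" "h \<in> Arr C" "Dom C h = Cod C g"
    "x \<in> Arr C" "Cod C x = Dom C f \<amalg> Dom C g"
  shows "h \<cdot> (copair f g \<cdot> x) = copair (h \<cdot> f) (h \<cdot> g) \<cdot> x"
  using Comp_assoc'[of x "copair f g" h] assms by simp

lemma copair_inl_inr [simp]: "A \<in> Obj C \<Longrightarrow> B \<in> Obj C \<Longrightarrow> copair (inl A B) (inr A B) = Id C (A \<amalg> B)"
  by (rule cop_ext[of A B _ "A \<amalg> B"]) (auto intro!: homI)

lemma copair_zero [simp]:
  "A \<in> Obj C \<Longrightarrow> B \<in> Obj C \<Longrightarrow> D \<in> Obj C \<Longrightarrow> copair (zero A D) (zero B D) = zero (A \<amalg> B) D"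
  by (rule cop_ext[of A B _ D]) (auto intro!: homI)

lemma copair_eq_iff:
  assumes "f \<in> hom C A Y" "g \<in> hom C B Y" "f' \<in> hom C A Y" "g' \<in> hom C B Y"
  shows "copair f g = copair f' g' \<longleftrightarrow> f = f' \<and> g = g'"
  by (metis assms homD(1-3) copair_inl copair_inr)

lemma cosum_simps [simp]:
  assumes "f \<in> Arr C" "g \<in> Arr C"
  shows "cosum f g \<in> Arr C" "Dom C (cosum f g) = Dom C f \<amalg> Dom C g"
    "Cod C (cosum f g) = Cod C f \<amalg> Cod C g"
  using assms by (simp_all add: cosum_def)

section \<open>Binary products\<close>

lemma product_exists:
  assumes A: "A \<in> Obj C" and B: "B \<in> Obj C"
  shows "is_product A B (proj1 A B) (proj2 A B)"
proof -
  obtain T where T: "is_terminal T" using finite_limits unfolding finitely_complete_def by blast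
  obtain a b where ab: "a \<in> hom C A T" "b \<in> hom C B T"
    using T A B unfolding is_terminal_def by blast
  \<comment> \<open>A product is a pullback over the terminal object, where the commutation
    condition is automatic.\<close>
  obtain p q where pq: "is_pullback a b p q"
    using pullback_exists[of a b] homD[OF ab(1)] homD[OF ab(2)] by auto
  have "is_product A B p q"
    unfolding is_product_def
  proof (intro conjI allI ballI)
    show "p \<in> hom C (Dom C p) A" "q \<in> hom C (Dom C p) B"
      using pq homD[OF ab(1)] homD[OF ab(2)] unfolding is_pullback_def by auto
    fix Y f g assume f: "f \<in> hom C Y A" and g: "g \<in> hom C Y B"
    have "a \<cdot> f = b \<cdot> g"
      using T Comp_in_hom[OF f ab(1)] Comp_in_hom[OF g ab(2)] homD[OF f]
      unfolding is_terminal_def by blast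
    then show "\<exists>!h. h \<in> hom C Y (Dom C p) \<and> p \<cdot> h = f \<and> q \<cdot> h = g"
      using pq f g homD[OF ab(1)] homD[OF ab(2)] unfolding is_pullback_def by simp
  qed
  then show ?thesis
    using someI[of "\<lambda>pq. is_product A B (fst pq) (snd pq)" "(p, q)"]
    unfolding proj1_def proj2_def by simp
qed

lemma proj_simps [simp]:
  assumes "A \<in> Obj C" "B \<in> Obj C"
  shows "proj1 A B \<in> Arr C" "Dom C (proj1 A B) = prd A B" "Cod C (proj1 A B) = A"
    "proj2 A B \<in> Arr C" "Dom C (proj2 A B) = prd A B" "Cod C (proj2 A B) = B"
  using product_exists[OF assms] unfolding is_product_def hom_def prd_def by auto

lemma prd_Obj [simp]: "A \<in> Obj C \<Longrightarrow> B \<in> Obj C \<Longrightarrow> prd A B \<in> Obj C"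
  by (metis proj_simps(1,2) Obj_simps(1))

lemma prd_ext:
  assumes "A \<in> Obj C" "B \<in> Obj C" and f: "f \<in> hom C Y (prd A B)" and g: "g \<in> hom C Y (prd A B)"
    and "proj1 A B \<cdot> f = proj1 A B \<cdot> g" "proj2 A B \<cdot> f = proj2 A B \<cdot> g"
  shows "f = g"
proof -
  have "proj1 A B \<cdot> g \<in> hom C Y A" "proj2 A B \<cdot> g \<in> hom C Y B"
    using homD[OF g] assms(1,2) by (simp_all add: homI)
  then have "\<exists>!h. h \<in> hom C Y (prd A B) \<and> proj1 A B \<cdot> h = proj1 A B \<cdot> g \<and> proj2 A B \<cdot> h = proj2 A B \<cdot> g"
    using product_exists[OF assms(1,2)] unfolding is_product_def prd_def by blast
  then show ?thesis using f g assms(5,6) by blast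
qed

lemma pair_char:
  assumes "f \<in> Arr C" "g \<in> Arr C" "Dom C f = Dom C g"
  shows "pair f g \<in> hom C (Dom C f) (prd (Cod C f) (Cod C g)) \<and>
    proj1 (Cod C f) (Cod C g) \<cdot> pair f g = f \<and> proj2 (Cod C f) (Cod C g) \<cdot> pair f g = g"
  unfolding pair_def
proof (rule theI')
  have "f \<in> hom C (Dom C f) (Cod C f)" "g \<in> hom C (Dom C f) (Cod C g)"
    using assms by (auto simp: hom_def)
  then show "\<exists>!h. h \<in> hom C (Dom C f) (prd (Cod C f) (Cod C g)) \<and>
    proj1 (Cod C f) (Cod C g) \<cdot> h = f \<and> proj2 (Cod C f) (Cod C g) \<cdot> h = g"
    using product_exists[of "Cod C f" "Cod C g"] assms
    unfolding is_product_def prd_def by simp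
qed

lemma pair_simps [simp]:
  assumes "f \<in> Arr C" "g \<in> Arr C" "Dom C f = Dom C g"
  shows "pair f g \<in> Arr C" "Dom C (pair f g) = Dom C g"
    "Cod C (pair f g) = prd (Cod C f) (Cod C g)"
  using pair_char[OF assms] assms(3) by (auto simp: hom_def)

lemma pair_Comp [simp]:
  assumes fg: "f \<in> Arr C" "g \<in> Arr C" "Dom C f = Dom C g" and x: "x \<in> Arr C" "Cod C x = Dom C g"
  shows "pair f g \<cdot> x = pair (f \<cdot> x) (g \<cdot> x)"
proof -
  let ?A = "Cod C f" and ?B = "Cod C g"
  note c = pair_char[OF fg]
  note c' = pair_char[of "f \<cdot> x" "g \<cdot> x"]
  show ?thesis
  proof (rule prd_ext[of ?A ?B _ "Dom C x"])
    show "proj1 ?A ?B \<cdot> (pair f g \<cdot> x) = proj1 ?A ?B \<cdot> pair (f \<cdot> x) (g \<cdot> x)"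
      using Comp_assoc'[of x "pair f g" "proj1 ?A ?B"] c c' fg x by simp
    show "proj2 ?A ?B \<cdot> (pair f g \<cdot> x) = proj2 ?A ?B \<cdot> pair (f \<cdot> x) (g \<cdot> x)"
      using Comp_assoc'[of x "pair f g" "proj2 ?A ?B"] c c' fg x by simp
  qed (use fg x in \<open>auto intro!: homI\<close>)
qed

lemma pair_eq_iff:
  assumes "f \<in> hom C Y A" "g \<in> hom C Y B" "f' \<in> hom C Y A" "g' \<in> hom C Y B"
  shows "pair f g = pair f' g' \<longleftrightarrow> f = f' \<and> g = g'"
  by (metis assms homD(1-3) pair_char)

lemma pair_zero [simp]:
  assumes "Y \<in> Obj C" "A \<in> Obj C" "B \<in> Obj C"
  shows "pair (zero Y A) (zero Y B) = zero Y (prd A B)"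
  by (rule prd_ext[of A B _ Y]) (use pair_char[of "zero Y A" "zero Y B"] assms in \<open>auto intro!: homI\<close>)

lemma pair_eq_zero_iff:
  assumes "f \<in> hom C Y A" "g \<in> hom C Y B"
  shows "pair f g = zero Y (prd A B) \<longleftrightarrow> f = zero Y A \<and> g = zero Y B"
proof -
  have "zero Y A \<in> hom C Y A" "zero Y B \<in> hom C Y B"
    using homD[OF assms(1)] homD[OF assms(2)] by (simp_all add: homI)
  from pair_eq_iff[OF assms this] show ?thesis
    using homD[OF assms(1)] homD[OF assms(2)] by simp
qed

section \<open>Kernels and their factorisations\<close>

lemma kernel_exists:
  assumes f: "f \<in> Arr C"
  shows "is_kernel f (ker f)"
proof -
  obtain Z where Z: "is_zero_object Z" using pointed unfolding pointed_def by blast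
  note ZO = zero_object_Obj[OF Z]
  let ?z = "zero Z (Cod C f)"
  \<comment> \<open>The kernel is the pullback of \<open>f\<close> along the map from the zero
    object.\<close>
  obtain p q where pq: "is_pullback f ?z p q"
    using pullback_exists[of f ?z] f ZO by auto
  have p: "p \<in> Arr C" "Cod C p = Dom C f" and q: "q \<in> hom C (Dom C p) Z" and eq: "f \<cdot> p = ?z \<cdot> q"
    using is_pullbackD[OF pq] homD[OF is_pullbackD(1)[OF pq]] ZO f by simp_all
  have "is_kernel f p"
    unfolding is_kernel_def
  proof (intro conjI allI ballI impI)
    show "f \<cdot> p = zero (Dom C p) (Cod C f)" using eq homD[OF q] f by simp
    fix Y a assume a: "a \<in> hom C Y (Dom C f)" and fa: "f \<cdot> a = zero Y (Cod C f)"
    have zY: "zero Y Z \<in> hom C Y Z" and "f \<cdot> a = ?z \<cdot> zero Y Z"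
      using homD[OF a] ZO f fa by (simp_all add: homI)
    then have ex: "\<exists>!h. h \<in> hom C Y (Dom C p) \<and> p \<cdot> h = a \<and> q \<cdot> h = zero Y Z"
      using is_pullback_ex1[OF pq a, of "zero Y Z"] ZO f by simp
    \<comment> \<open>Maps into a zero object are unique, so the condition on the second projection
      holds by itself.\<close>
    have "q \<cdot> h = zero Y Z" if "h \<in> hom C Y (Dom C p)" for h
      by (rule zero_object_to_unique[OF Z Comp_in_hom[OF that q] zY])
    with ex show "\<exists>!h. h \<in> hom C Y (Dom C p) \<and> p \<cdot> h = a" by metis
  qed (use f p in \<open>simp_all add: homI\<close>)
  then show ?thesis unfolding ker_def by (rule someI[of "is_kernel f"])
qed

lemma ker_simps [simp]:
  assumes "f \<in> Arr C"
  shows "ker f \<in> Arr C" "Cod C (ker f) = Dom C f" "f \<cdot> ker f = zero (Dom C (ker f)) (Cod C f)"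
  using kernel_exists[OF assms] unfolding is_kernel_def by (auto simp: hom_def)

lemma ker_Comp [simp]:
  assumes "f \<in> Arr C" "x \<in> Arr C" "Cod C x = Dom C (ker f)"
  shows "f \<cdot> (ker f \<cdot> x) = zero (Dom C x) (Cod C f)"
  using Comp_assoc'[of x "ker f" f] assms by simp

lemma ker_factor_unique:
  assumes f: "f \<in> Arr C" and a: "a \<in> Arr C" "Cod C a = Dom C f" and fa: "f \<cdot> a = zero (Dom C a) (Cod C f)"
  shows "\<exists>!h. h \<in> hom C (Dom C a) (Dom C (ker f)) \<and> ker f \<cdot> h = a"
  using kernel_exists[OF f] homI[OF a(1) refl a(2)] fa unfolding is_kernel_def by simp

lemma ker_mono:
  assumes f: "f \<in> Arr C" and eq: "ker f \<cdot> a = ker f \<cdot> b" and ab: "a \<in> Arr C" "b \<in> Arr C"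
    "Cod C a = Dom C (ker f)" "Cod C b = Dom C (ker f)" "Dom C a = Dom C b"
  shows "a = b"
proof -
  have "\<exists>!h. h \<in> hom C (Dom C b) (Dom C (ker f)) \<and> ker f \<cdot> h = ker f \<cdot> b"
    using ker_factor_unique[of f "ker f \<cdot> b"] f ab by simp
  moreover have "a \<in> hom C (Dom C b) (Dom C (ker f))" "b \<in> hom C (Dom C b) (Dom C (ker f))"
    using ab by (auto intro: homI)
  ultimately show ?thesis using eq by blast
qed

lemma factor_ker:
  assumes "f \<in> Arr C" "a \<in> Arr C" "Cod C a = Dom C f" "f \<cdot> a = zero (Dom C a) (Cod C f)"
  shows "factor (ker f) a \<in> Arr C" "Dom C (factor (ker f) a) = Dom C a"
    "Cod C (factor (ker f) a) = Dom C (ker f)" "ker f \<cdot> factor (ker f) a = a"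
  using theI'[OF ker_factor_unique[OF assms]] unfolding factor_def by (auto simp: hom_def)

section \<open>Equalisers and jointly epic families\<close>

lemma equaliser_exists:
  assumes u: "u \<in> hom C X P" and v: "v \<in> hom C X P"
  obtains e where "e \<in> Arr C" "Cod C e = X" "u \<cdot> e = v \<cdot> e"
    "\<And>Y a. a \<in> hom C Y X \<Longrightarrow> u \<cdot> a = v \<cdot> a \<Longrightarrow> \<exists>!h. h \<in> hom C Y (Dom C e) \<and> e \<cdot> h = a"
proof -
  note uv = homD[OF u] homD[OF v]
  let ?u = "pair (Id C X) u" and ?v = "pair (Id C X) v"
  \<comment> \<open>The equaliser is the pullback of the graphs \<open>(1, u)\<close> and
    \<open>(1, v)\<close>. First components force the two projections to coincide, and second
    components then give \<open>u \<cdot> e = v \<cdot> e\<close>.\<close>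
  obtain e e' where pb: "is_pullback ?u ?v e e'"
    using pullback_exists[of ?u ?v] uv by auto
  have e: "e \<in> Arr C" "Cod C e = X" "e' \<in> Arr C" "Cod C e' = X" "Dom C e' = Dom C e"
    and eq: "?u \<cdot> e = ?v \<cdot> e'"
    using is_pullbackD(3)[OF pb] homD[OF is_pullbackD(1)[OF pb]] homD[OF is_pullbackD(2)[OF pb]] uv
    by simp_all
  have hom: "e \<in> hom C (Dom C e) X" "u \<cdot> e \<in> hom C (Dom C e) P" "e' \<in> hom C (Dom C e) X"
    "v \<cdot> e' \<in> hom C (Dom C e) P"
    using e uv by (simp_all add: homI)
  have "pair e (u \<cdot> e) = pair e' (v \<cdot> e')" using eq e uv by simp
  then have "e = e' \<and> u \<cdot> e = v \<cdot> e'" by (rule iffD1[OF pair_eq_iff[OF hom]])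
  then have e': "e' = e" and ue: "u \<cdot> e = v \<cdot> e" by auto
  show thesis
  proof (rule that[OF e(1,2) ue])
    fix Y a assume a: "a \<in> hom C Y X" and "u \<cdot> a = v \<cdot> a"
    then have "?u \<cdot> a = ?v \<cdot> a" using uv homD[OF a] by simp
    then show "\<exists>!h. h \<in> hom C Y (Dom C e) \<and> e \<cdot> h = a"
      using is_pullback_ex1[OF pb, of a Y a] a uv e' by simp
  qed
qed

text \<open>Protomodularity speaks of pullbacks, so a kernel is presented as change of base along
  the zero object. \<open>k\<close> is an arbitrary kernel rather than the chosen one, which covers
  the lift \<open>k'\<close> used for the point restricted to an equaliser.\<close>

lemma kernel_is_pullback:
  assumes Z: "is_zero_object Z" and f: "f \<in> Arr C"
    and k: "k \<in> Arr C" "Cod C k = Dom C f" "f \<cdot> k = zero (Dom C k) (Cod C f)"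
    and univ: "\<And>Y a. a \<in> hom C Y (Dom C f) \<Longrightarrow> f \<cdot> a = zero Y (Cod C f) \<Longrightarrow>
      \<exists>!h. h \<in> hom C Y (Dom C k) \<and> k \<cdot> h = a"
  shows "is_pullback f (zero Z (Cod C f)) k (zero (Dom C k) Z)"
proof -
  note ZO = zero_object_Obj[OF Z]
  show ?thesis
    unfolding is_pullback_def
  proof (intro conjI allI ballI impI)
    fix Y a b assume a: "a \<in> hom C Y (Dom C f)" and b: "b \<in> hom C Y (Dom C (zero Z (Cod C f)))"
      and "f \<cdot> a = zero Z (Cod C f) \<cdot> b"
    then have "f \<cdot> a = zero Y (Cod C f)" using ZO f homD[OF b] by simp
    from univ[OF a this] have ex: "\<exists>!h. h \<in> hom C Y (Dom C k) \<and> k \<cdot> h = a" .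
    have "zero (Dom C k) Z \<cdot> h = b" if "h \<in> hom C Y (Dom C k)" for h
    proof -
      have "zero (Dom C k) Z \<cdot> h \<in> hom C Y Z" "b \<in> hom C Y Z"
        using homD[OF that] b ZO k f by (auto simp: homI)
      then show ?thesis by (rule zero_object_to_unique[OF Z])
    qed
    with ex show "\<exists>!h. h \<in> hom C Y (Dom C k) \<and> k \<cdot> h = a \<and> zero (Dom C k) Z \<cdot> h = b"
      by metis
  qed (use f k ZO in \<open>simp_all add: homI\<close>)
qed

text \<open>The equaliser of \<open>u\<close> and \<open>v\<close> contains the section and the kernel, so as a morphism of points
  it restricts to an isomorphism between the fibres over zero.\<close>

lemma point_jointly_epic:
  assumes pt: "is_point B f s"
    and u: "u \<in> hom C (Dom C f) P" and v: "v \<in> hom C (Dom C f) P"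
    and k: "u \<cdot> ker f = v \<cdot> ker f" and s: "u \<cdot> s = v \<cdot> s"
  shows "u = v"
proof -
  have f: "f \<in> Arr C" "Cod C f = B" and sh: "s \<in> hom C B (Dom C f)" and fs: "f \<cdot> s = Id C B"
    using pt unfolding is_point_def by (auto simp: hom_def)
  note uv = homD[OF u] homD[OF v] homD[OF sh]
  obtain e where e: "e \<in> Arr C" "Cod C e = Dom C f" "u \<cdot> e = v \<cdot> e"
    and eu: "\<And>Y a. a \<in> hom C Y (Dom C f) \<Longrightarrow> u \<cdot> a = v \<cdot> a \<Longrightarrow>
      \<exists>!h. h \<in> hom C Y (Dom C e) \<and> e \<cdot> h = a"
    using equaliser_exists[OF u v] by metis
  have kf: "ker f \<in> hom C (Dom C (ker f)) (Dom C f)" using f by (simp add: homI)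
  obtain s' where s': "s' \<in> hom C B (Dom C e)" "e \<cdot> s' = s" using eu[OF sh s] by blast
  obtain k' where k': "k' \<in> hom C (Dom C (ker f)) (Dom C e)" "e \<cdot> k' = ker f"
    using eu[OF kf k] by blast
  note D = homD[OF s'(1)] homD[OF k'(1)]
  obtain Z where Z: "is_zero_object Z" using pointed unfolding pointed_def by blast
  note ZO = zero_object_Obj[OF Z]
  have cod: "Cod C (f \<cdot> e) = B" "Dom C (f \<cdot> e) = Dom C e" using f e by auto
  have pb: "is_pullback f (zero Z B) (ker f) (zero (Dom C (ker f)) Z)"
    using kernel_is_pullback[OF Z f(1), of "ker f"] kernel_exists[OF f(1)] f
    unfolding is_kernel_def by simp
  \<comment> \<open>The kernel of \<open>f \<cdot> e\<close> is \<open>k'\<close>: if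
    \<open>f \<cdot> e \<cdot> a\<close> vanishes, then \<open>e \<cdot> a\<close> factors through
    \<open>ker f = e \<cdot> k'\<close>, and uniqueness in the equaliser cancels
    \<open>e\<close>.\<close>
  have pb': "is_pullback (f \<cdot> e) (zero Z B) k' (zero (Dom C k') Z)"
  proof -
    have "\<exists>!h. h \<in> hom C Y (Dom C k') \<and> k' \<cdot> h = a"
      if a: "a \<in> hom C Y (Dom C e)" and z: "f \<cdot> e \<cdot> a = zero Y B" for Y a
    proof -
      have "\<exists>!h. h \<in> hom C Y (Dom C k') \<and> ker f \<cdot> h = e \<cdot> a"
        using ker_factor_unique[of f "e \<cdot> a"] f e homD[OF a] z D by simp
      moreover have "k' \<cdot> h = a \<longleftrightarrow> ker f \<cdot> h = e \<cdot> a" if h: "h \<in> hom C Y (Dom C k')" for h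
      proof
        assume "k' \<cdot> h = a"
        then show "ker f \<cdot> h = e \<cdot> a"
          using Comp_assoc'[of h k' e] k'(2) D e homD[OF h] by simp
      next
        assume eq: "ker f \<cdot> h = e \<cdot> a"
        have 1: "k' \<cdot> h \<in> hom C Y (Dom C e)" "e \<cdot> a \<in> hom C Y (Dom C f)"
          using homD[OF h] homD[OF a] D e by (simp_all add: homI)
        have 2: "e \<cdot> (k' \<cdot> h) = e \<cdot> a"
          using Comp_assoc'[of h k' e] k'(2) D e homD[OF h] eq by simp
        have "u \<cdot> (e \<cdot> a) = v \<cdot> (e \<cdot> a)"
          using Comp_assoc'[of a e u] Comp_assoc'[of a e v] e uv homD[OF a] by simp
        from eu[OF 1(2) this] show "k' \<cdot> h = a" using 1(1) 2 a by blast
      qed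
      ultimately show ?thesis by auto
    qed
    moreover have "f \<cdot> e \<cdot> k' = zero (Dom C k') B" using f e D k'(2) by simp
    ultimately show ?thesis
      using kernel_is_pullback[OF Z, of "f \<cdot> e" k'] f e D by simp
  qed
  have pt': "is_point B (f \<cdot> e) s'"
    unfolding is_point_def using f e D s' fs by (simp add: homI)
  \<comment> \<open>Change of base along \<open>zero Z B\<close> sends the morphism of points
    \<open>e\<close> to the identity, because \<open>k'\<close> and \<open>ker f\<close> have the
    same domain.\<close>
  have "iso e"
  proof -
    have "zero Z B \<in> hom C Z B \<and> is_point B (f \<cdot> e) s' \<and> is_point B f s \<and>
      e \<in> hom C (Dom C (f \<cdot> e)) (Dom C f) \<and> f \<cdot> e = f \<cdot> e \<and> e \<cdot> s' = s \<and>
      is_pullback (f \<cdot> e) (zero Z B) k' (zero (Dom C k') Z) \<and>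
      is_pullback f (zero Z B) (ker f) (zero (Dom C (ker f)) Z) \<and>
      Id C (Dom C k') \<in> hom C (Dom C k') (Dom C (ker f)) \<and>
      ker f \<cdot> Id C (Dom C k') = e \<cdot> k' \<and>
      zero (Dom C (ker f)) Z \<cdot> Id C (Dom C k') = zero (Dom C k') Z \<and> iso (Id C (Dom C k'))"
      using ZO uv pt pt' e f s' pb pb' D k' iso_Id by (simp add: homI)
    then show ?thesis using protomodular unfolding protomodular_def by blast
  qed
  then obtain g where g: "g \<in> hom C (Dom C f) (Dom C e)" "e \<cdot> g = Id C (Dom C f)"
    unfolding iso_def using e by auto
  have "u \<cdot> (e \<cdot> g) = v \<cdot> (e \<cdot> g)"
    using Comp_assoc'[of g e u] Comp_assoc'[of g e v] e uv homD[OF g(1)] by simp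
  then show ?thesis using uv g(2) by simp
qed

subsection \<open>The objects \<open>A \<flat> B\<close> and cosmash products\<close>

lemma kflat_simps [simp]:
  assumes "A \<in> Obj C" "B \<in> Obj C"
  shows "kflat A B \<in> Arr C" "Dom C (kflat A B) = A \<flat> B" "Cod C (kflat A B) = A \<amalg> B"
    "copair (Id C A) (zero B A) \<cdot> kflat A B = zero (A \<flat> B) A"
  using assms by (simp_all add: kflat_def flat_def)

lemma flat_Obj [simp]: "A \<in> Obj C \<Longrightarrow> B \<in> Obj C \<Longrightarrow> A \<flat> B \<in> Obj C"
  by (metis kflat_simps(1,2) Obj_simps(1))

lemma kflat_mono:
  assumes "A \<in> Obj C" "B \<in> Obj C" "kflat A B \<cdot> a = kflat A B \<cdot> b"
    "a \<in> Arr C" "b \<in> Arr C" "Cod C a = A \<flat> B" "Cod C b = A \<flat> B" "Dom C a = Dom C b"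
  shows "a = b"
  by (rule ker_mono[of "copair (Id C A) (zero B A)"]) (use assms in \<open>simp_all add: kflat_def flat_def\<close>)

lemma factor_kflat:
  assumes "A \<in> Obj C" "B \<in> Obj C" "a \<in> Arr C" "Cod C a = A \<amalg> B"
    "copair (Id C A) (zero B A) \<cdot> a = zero (Dom C a) A"
  shows "factor (kflat A B) a \<in> Arr C" "Dom C (factor (kflat A B) a) = Dom C a"
    "Cod C (factor (kflat A B) a) = A \<flat> B" "kflat A B \<cdot> factor (kflat A B) a = a"
  using factor_ker[of "copair (Id C A) (zero B A)" a] assms by (simp_all add: kflat_def flat_def)

lemma flat_map_simps [simp]:
  assumes f: "f \<in> Arr C" and g: "g \<in> Arr C"
    and dom: "Dom C f = A" "Dom C g = B" and cod: "Cod C f = A'" "Cod C g = B'"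
  shows "flat_map f g \<in> Arr C" "Dom C (flat_map f g) = A \<flat> B" "Cod C (flat_map f g) = A' \<flat> B'"
    "kflat A' B' \<cdot> flat_map f g = cosum f g \<cdot> kflat A B"
proof -
  have obj: "A \<in> Obj C" "B \<in> Obj C" "A' \<in> Obj C" "B' \<in> Obj C" using assms by auto
  have "copair (Id C A') (zero B' A') \<cdot> (cosum f g \<cdot> kflat A B) = copair f (zero B A') \<cdot> kflat A B"
    using assms obj by (simp add: cosum_def)
  \<comment> \<open>Pulling \<open>f\<close> out in front lets \<open>[1, 0]\<close> meet its
    kernel. The deleted rules would evaluate the kernel equation too early or push \<open>f\<close>
    back inside.\<close>
  also have "\<dots> = f \<cdot> (copair (Id C A) (zero B A) \<cdot> kflat A B)"
    using assms obj by (simp del: kflat_simps(4))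
  also have "\<dots> = zero (A \<flat> B) A'"
    using f dom cod obj by (simp del: Comp_copair Comp_copair_Comp)
  finally show "flat_map f g \<in> Arr C" "Dom C (flat_map f g) = A \<flat> B" "Cod C (flat_map f g) = A' \<flat> B'"
    "kflat A' B' \<cdot> flat_map f g = cosum f g \<cdot> kflat A B"
    using factor_kflat[of A' B' "cosum f g \<cdot> kflat A B"] assms obj
    by (simp_all add: flat_map_def)
qed

section \<open>Cosmash products and folding morphisms\<close>

lemma h2_simps [simp]:
  assumes "A \<in> Obj C" "B \<in> Obj C"
  shows "h2 A B \<in> Arr C" "Cod C (h2 A B) = A \<amalg> B"
    "copair (Id C A) (zero B A) \<cdot> h2 A B = zero (Dom C (h2 A B)) A"
    "copair (zero A B) (Id C B) \<cdot> h2 A B = zero (Dom C (h2 A B)) B"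
proof -
  let ?f = "copair (Id C A) (zero B A)" and ?g = "copair (zero A B) (Id C B)"
  have h: "h2 A B \<in> Arr C" "Cod C (h2 A B) = A \<amalg> B"
    using assms by (simp_all add: h2_def)
  \<comment> \<open>The kernel of a map into a product is the joint kernel of its
    components.\<close>
  have "pair (?f \<cdot> h2 A B) (?g \<cdot> h2 A B) = pair ?f ?g \<cdot> h2 A B" using h assms by simp
  also have "\<dots> = zero (Dom C (h2 A B)) (prd A B)"
    using assms unfolding h2_def by (simp del: pair_Comp)
  finally have "?f \<cdot> h2 A B = zero (Dom C (h2 A B)) A \<and> ?g \<cdot> h2 A B = zero (Dom C (h2 A B)) B"
    by (rule iffD1[OF pair_eq_zero_iff, rotated -1]) (use h assms in \<open>simp_all add: homI\<close>)
  then show "h2 A B \<in> Arr C" "Cod C (h2 A B) = A \<amalg> B"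
    "?f \<cdot> h2 A B = zero (Dom C (h2 A B)) A" "?g \<cdot> h2 A B = zero (Dom C (h2 A B)) B"
    using h by auto
qed

lemma factor_h2:
  assumes "A \<in> Obj C" "B \<in> Obj C" "a \<in> Arr C" "Cod C a = A \<amalg> B"
    "copair (Id C A) (zero B A) \<cdot> a = zero (Dom C a) A"
    "copair (zero A B) (Id C B) \<cdot> a = zero (Dom C a) B"
  shows "factor (h2 A B) a \<in> Arr C" "Dom C (factor (h2 A B) a) = Dom C a"
    "Cod C (factor (h2 A B) a) = Dom C (h2 A B)" "h2 A B \<cdot> factor (h2 A B) a = a"
  using factor_ker[of "pair (copair (Id C A) (zero B A)) (copair (zero A B) (Id C B))" a] assms
  by (simp_all add: h2_def)

lemma i_cosmash_simps [simp]:
  assumes "A \<in> Obj C" "B \<in> Obj C"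
  shows "i_cosmash A B \<in> Arr C" "Dom C (i_cosmash A B) = Dom C (h2 A B)"
    "Cod C (i_cosmash A B) = A \<flat> B" "kflat A B \<cdot> i_cosmash A B = h2 A B"
  using factor_kflat[of A B "h2 A B"] assms by (simp_all add: i_cosmash_def)

text \<open>Each of the three maps collapses one summand; in the first,
  \<open>copair (inl A B) (inr A B)\<close> appears in its simplified form as an identity. The
  defining map lands in a nested product, so its vanishing is split into components twice.\<close>

lemma h3_simps [simp]:
  assumes "A \<in> Obj C" "B \<in> Obj C" "D \<in> Obj C"
  shows "h3 A B D \<in> Arr C" "Cod C (h3 A B D) = A \<amalg> B \<amalg> D"
    "copair (Id C (A \<amalg> B)) (zero D (A \<amalg> B)) \<cdot> h3 A B D = zero (Dom C (h3 A B D)) (A \<amalg> B)"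
    "copair (copair (inl A D) (zero B (A \<amalg> D))) (inr A D) \<cdot> h3 A B D = zero (Dom C (h3 A B D)) (A \<amalg> D)"
    "copair (copair (zero A (B \<amalg> D)) (inl B D)) (inr B D) \<cdot> h3 A B D = zero (Dom C (h3 A B D)) (B \<amalg> D)"
proof -
  let ?f = "copair (Id C (A \<amalg> B)) (zero D (A \<amalg> B))"
    and ?g = "copair (copair (inl A D) (zero B (A \<amalg> D))) (inr A D)"
    and ?k = "copair (copair (zero A (B \<amalg> D)) (inl B D)) (inr B D)"
  let ?h = "h3 A B D"
  have hd: "?h = ker (pair (pair ?f ?g) ?k)" using assms by (simp add: h3_def)
  have h: "?h \<in> Arr C" "Cod C ?h = A \<amalg> B \<amalg> D"
    using assms by (simp_all add: hd)
  have "pair (pair (?f \<cdot> ?h) (?g \<cdot> ?h)) (?k \<cdot> ?h) = pair (pair ?f ?g) ?k \<cdot> ?h" using h assms by simp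
  also have "\<dots> = zero (Dom C ?h) (prd (prd (A \<amalg> B) (A \<amalg> D)) (B \<amalg> D))"
    using assms unfolding hd by (simp del: pair_Comp)
  finally have 1: "pair (?f \<cdot> ?h) (?g \<cdot> ?h) = zero (Dom C ?h) (prd (A \<amalg> B) (A \<amalg> D)) \<and>
      ?k \<cdot> ?h = zero (Dom C ?h) (B \<amalg> D)"
    by (rule iffD1[OF pair_eq_zero_iff, rotated -1]) (use h assms in \<open>simp_all add: homI\<close>)
  from 1[THEN conjunct1] have "?f \<cdot> ?h = zero (Dom C ?h) (A \<amalg> B) \<and> ?g \<cdot> ?h = zero (Dom C ?h) (A \<amalg> D)"
    by (rule iffD1[OF pair_eq_zero_iff, rotated -1]) (use h assms in \<open>simp_all add: homI\<close>)
  then show "h3 A B D \<in> Arr C" "Cod C (h3 A B D) = A \<amalg> B \<amalg> D"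
    "?f \<cdot> ?h = zero (Dom C ?h) (A \<amalg> B)" "?g \<cdot> ?h = zero (Dom C ?h) (A \<amalg> D)"
    "?k \<cdot> ?h = zero (Dom C ?h) (B \<amalg> D)"
    using h 1 by auto
qed

lemma factor_h3:
  assumes "A \<in> Obj C" "B \<in> Obj C" "D \<in> Obj C" "a \<in> Arr C" "Cod C a = A \<amalg> B \<amalg> D"
    "copair (Id C (A \<amalg> B)) (zero D (A \<amalg> B)) \<cdot> a = zero (Dom C a) (A \<amalg> B)"
    "copair (copair (inl A D) (zero B (A \<amalg> D))) (inr A D) \<cdot> a = zero (Dom C a) (A \<amalg> D)"
    "copair (copair (zero A (B \<amalg> D)) (inl B D)) (inr B D) \<cdot> a = zero (Dom C a) (B \<amalg> D)"
  shows "factor (h3 A B D) a \<in> Arr C" "Dom C (factor (h3 A B D) a) = Dom C a"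
    "Cod C (factor (h3 A B D) a) = Dom C (h3 A B D)" "h3 A B D \<cdot> factor (h3 A B D) a = a"
  using factor_ker[of "pair (pair (copair (Id C (A \<amalg> B)) (zero D (A \<amalg> B)))
    (copair (copair (inl A D) (zero B (A \<amalg> D))) (inr A D)))
    (copair (copair (zero A (B \<amalg> D)) (inl B D)) (inr B D))" a] assms
  by (simp_all add: h3_def)

lemma j3_simps [simp]:
  assumes "A \<in> Obj C" "B \<in> Obj C" "D \<in> Obj C"
  shows "j3 A B D \<in> Arr C" "Dom C (j3 A B D) = Dom C (h3 A B D)"
    "Cod C (j3 A B D) = (A \<amalg> B) \<flat> D" "kflat (A \<amalg> B) D \<cdot> j3 A B D = h3 A B D"
  using factor_kflat[of "A \<amalg> B" D "h3 A B D"] assms by (simp_all add: j3_def)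

text \<open>The folded map lands in the cosmash product because both projections kill it: the one to
  \<open>N\<close> factors through the collapse of the last \<open>M\<close>, the one to
  \<open>M\<close> through the collapse of the middle \<open>N\<close>, and \<open>h3\<close> is
  killed by both collapses.\<close>

lemma fold_outer_simps:
  assumes "M \<in> Obj C" "N \<in> Obj C"
  shows "fold_outer N M \<in> Arr C" "Dom C (fold_outer N M) = Dom C (h3 M N M)"
    "Cod C (fold_outer N M) = Dom C (h2 N M)"
    "h2 N M \<cdot> fold_outer N M = copair (copair (inr N M) (inl N M)) (inr N M) \<cdot> h3 M N M"
proof -
  let ?a = "copair (copair (inr N M) (inl N M)) (inr N M) \<cdot> h3 M N M"
  have "copair (Id C N) (zero M N) \<cdot> ?a = copair (copair (zero M N) (Id C N)) (zero M N) \<cdot> h3 M N M"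
    using assms by simp
  also have "\<dots> = copair (zero M N) (Id C N) \<cdot> (copair (Id C (M \<amalg> N)) (zero M (M \<amalg> N)) \<cdot> h3 M N M)"
    using assms by (simp del: h3_simps(3-5))
  also have "\<dots> = zero (Dom C ?a) N" using assms by (simp del: Comp_copair_Comp)
  finally have 1: "copair (Id C N) (zero M N) \<cdot> ?a = zero (Dom C ?a) N" .
  have "copair (zero N M) (Id C M) \<cdot> ?a = copair (copair (Id C M) (zero N M)) (Id C M) \<cdot> h3 M N M"
    using assms by simp
  also have "\<dots> = copair (Id C M) (Id C M) \<cdot>
      (copair (copair (inl M M) (zero N (M \<amalg> M))) (inr M M) \<cdot> h3 M N M)"
    using assms by (simp del: h3_simps(3-5))
  also have "\<dots> = zero (Dom C ?a) M" using assms by (simp del: Comp_copair_Comp)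
  finally have 2: "copair (zero N M) (Id C M) \<cdot> ?a = zero (Dom C ?a) M" .
  show "fold_outer N M \<in> Arr C" "Dom C (fold_outer N M) = Dom C (h3 M N M)"
    "Cod C (fold_outer N M) = Dom C (h2 N M)" "h2 N M \<cdot> fold_outer N M = ?a"
    using factor_h2[OF assms(2,1) _ _ 1 2] assms by (simp_all add: fold_outer_def)
qed

text \<open>Here the projection to \<open>M\<close> factors through the collapse of the last
  \<open>N\<close>, and the projection to \<open>N\<close> through the collapse of
  \<open>M\<close>.\<close>

lemma fold_right_simps:
  assumes "M \<in> Obj C" "N \<in> Obj C"
  shows "fold_right M N \<in> Arr C" "Dom C (fold_right M N) = Dom C (h3 M N N)"
    "Cod C (fold_right M N) = Dom C (h2 M N)"
    "h2 M N \<cdot> fold_right M N = copair (Id C (M \<amalg> N)) (inr M N) \<cdot> h3 M N N"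
proof -
  let ?a = "copair (Id C (M \<amalg> N)) (inr M N) \<cdot> h3 M N N"
  have "copair (Id C M) (zero N M) \<cdot> ?a = copair (copair (Id C M) (zero N M)) (zero N M) \<cdot> h3 M N N"
    using assms by simp
  also have "\<dots> = copair (Id C M) (zero N M) \<cdot> (copair (Id C (M \<amalg> N)) (zero N (M \<amalg> N)) \<cdot> h3 M N N)"
    using assms by (simp del: h3_simps(3-5))
  also have "\<dots> = zero (Dom C ?a) M" using assms by (simp del: Comp_copair_Comp)
  finally have 1: "copair (Id C M) (zero N M) \<cdot> ?a = zero (Dom C ?a) M" .
  have "copair (zero M N) (Id C N) \<cdot> ?a = copair (copair (zero M N) (Id C N)) (Id C N) \<cdot> h3 M N N"
    using assms by simp
  also have "\<dots> = copair (Id C N) (Id C N) \<cdot>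
      (copair (copair (zero M (N \<amalg> N)) (inl N N)) (inr N N) \<cdot> h3 M N N)"
    using assms by (simp del: h3_simps(3-5))
  also have "\<dots> = zero (Dom C ?a) N" using assms by (simp del: Comp_copair_Comp)
  finally have 2: "copair (zero M N) (Id C N) \<cdot> ?a = zero (Dom C ?a) N" .
  show "fold_right M N \<in> Arr C" "Dom C (fold_right M N) = Dom C (h3 M N N)"
    "Cod C (fold_right M N) = Dom C (h2 M N)" "h2 M N \<cdot> fold_right M N = ?a"
    using factor_h2[OF assms(1,2) _ _ 1 2] assms by (simp_all add: fold_right_def)
qed

text \<open>The point \<open>(A \<amalg> B) \<flat> D \<rightarrow> A \<flat> D\<close> has a kernel \<open>\<kappa>\<close> that is itself a point over the kernel \<open>l\<close>
  of \<open>B \<flat> D \<rightarrow> D\<close>, and the kernel of this second point factors through \<open>A \<diamond> B \<diamond> D\<close>.\<close>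

lemma flat_map_jointly_epic:
  assumes obj: "A \<in> Obj C" "B \<in> Obj C" "D \<in> Obj C"
    and u: "u \<in> hom C ((A \<amalg> B) \<flat> D) P" and v: "v \<in> hom C ((A \<amalg> B) \<flat> D) P"
    and left: "u \<cdot> flat_map (inl A B) (Id C D) = v \<cdot> flat_map (inl A B) (Id C D)"
    and right: "u \<cdot> flat_map (inr A B) (Id C D) = v \<cdot> flat_map (inr A B) (Id C D)"
    and cosmash: "u \<cdot> j3 A B D = v \<cdot> j3 A B D"
  shows "u = v"
proof -
  let ?k = "kflat (A \<amalg> B) D" and ?kA = "kflat A D" and ?kB = "kflat B D"
  let ?pA = "copair (Id C A) (zero B A)" and ?pB = "copair (zero A B) (Id C B)"
    and ?c = "copair (zero B D) (Id C D)"
  \<comment> \<open>\<open>f\<close> collapses \<open>B\<close> and is split by \<open>s\<close>;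
    \<open>f'\<close> collapses \<open>A\<close> and is split by \<open>s'\<close>.\<close>
  define f where "f = flat_map ?pA (Id C D)"
  define s where "s = flat_map (inl A B) (Id C D)"
  define f' where "f' = flat_map ?pB (Id C D)"
  define s' where "s' = flat_map (inr A B) (Id C D)"
  have f [simp]: "f \<in> Arr C" "Dom C f = (A \<amalg> B) \<flat> D" "Cod C f = A \<flat> D" "?kA \<cdot> f = cosum ?pA (Id C D) \<cdot> ?k"
    and s [simp]: "s \<in> Arr C" "Dom C s = A \<flat> D" "Cod C s = (A \<amalg> B) \<flat> D" "?k \<cdot> s = cosum (inl A B) (Id C D) \<cdot> ?kA"
    and f' [simp]: "f' \<in> Arr C" "Dom C f' = (A \<amalg> B) \<flat> D" "Cod C f' = B \<flat> D" "?kB \<cdot> f' = cosum ?pB (Id C D) \<cdot> ?k"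
    and s' [simp]: "s' \<in> Arr C" "Dom C s' = B \<flat> D" "Cod C s' = (A \<amalg> B) \<flat> D" "?k \<cdot> s' = cosum (inr A B) (Id C D) \<cdot> ?kB"
    using obj by (simp_all add: f_def s_def f'_def s'_def)
  note obj [simp]
  have uv [simp]: "u \<in> Arr C" "Dom C u = (A \<amalg> B) \<flat> D" "Cod C u = P" "v \<in> Arr C" "Dom C v = (A \<amalg> B) \<flat> D" "Cod C v = P"
    using homD[OF u] homD[OF v] by simp_all
  have fs: "f \<cdot> s = Id C (A \<flat> D)"
  proof (rule kflat_mono[of A D])
    have "?kA \<cdot> (f \<cdot> s) = cosum ?pA (Id C D) \<cdot> (?k \<cdot> s)" by (simp add: reassoc[OF f(4)] del: s(4))
    then show "?kA \<cdot> (f \<cdot> s) = ?kA \<cdot> Id C (A \<flat> D)" by (simp add: cosum_def)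
  qed (simp_all add: homI)
  have fs': "f' \<cdot> s' = Id C (B \<flat> D)"
  proof (rule kflat_mono[of B D])
    have "?kB \<cdot> (f' \<cdot> s') = cosum ?pB (Id C D) \<cdot> (?k \<cdot> s')" by (simp add: reassoc[OF f'(4)] del: s'(4))
    then show "?kB \<cdot> (f' \<cdot> s') = ?kB \<cdot> Id C (B \<flat> D)" by (simp add: cosum_def)
  qed (simp_all add: homI)
  define \<kappa> where "\<kappa> = ker f"
  have \<kappa> [simp]: "\<kappa> \<in> Arr C" "Cod C \<kappa> = (A \<amalg> B) \<flat> D" "f \<cdot> \<kappa> = zero (Dom C \<kappa>) (A \<flat> D)"
    by (simp_all add: \<kappa>_def)
  \<comment> \<open>Inside \<open>B \<flat> D\<close>, vanishing under the projection to
    \<open>D\<close> cuts out the cosmash product of \<open>B\<close> and \<open>D\<close>; so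
    \<open>l\<close> is a copy of \<open>i_cosmash B D\<close>.\<close>
  define l where "l = ker (?c \<cdot> ?kB)"
  have l [simp]: "l \<in> Arr C" "Cod C l = B \<flat> D"
    by (simp_all add: l_def)
  have cl: "?c \<cdot> (?kB \<cdot> l) = zero (Dom C l) D"
  proof -
    have "?c \<cdot> ?kB \<cdot> l = zero (Dom C l) D" unfolding l_def by (subst ker_simps(3)) simp_all
    then show ?thesis by simp
  qed
  \<comment> \<open>Collapsing \<open>B\<close> after including \<open>B \<flat> D\<close> leaves
    only the component in \<open>D\<close>, which \<open>l\<close> kills. Hence
    \<open>s' \<cdot> l\<close> lifts to the kernel of \<open>f\<close>, which gives the section
    \<open>t\<close>.\<close>
  have "f \<cdot> (s' \<cdot> l) = zero (Dom C l) (A \<flat> D)"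
  proof (rule kflat_mono[of A D])
    have "?kA \<cdot> (f \<cdot> (s' \<cdot> l)) = cosum ?pA (Id C D) \<cdot> (cosum (inr A B) (Id C D) \<cdot> (?kB \<cdot> l))"
      by (simp add: reassoc[OF f(4)] reassoc[OF s'(4)])
    also have "\<dots> = inr A D \<cdot> (?c \<cdot> (?kB \<cdot> l))" by (simp add: cosum_def)
    also have "\<dots> = ?kA \<cdot> zero (Dom C l) (A \<flat> D)" unfolding cl by simp
    finally show "?kA \<cdot> (f \<cdot> (s' \<cdot> l)) = ?kA \<cdot> zero (Dom C l) (A \<flat> D)" .
  qed (simp_all add: homI)
  then obtain t where t [simp]: "t \<in> Arr C" "Dom C t = Dom C l" "Cod C t = Dom C \<kappa>" "\<kappa> \<cdot> t = s' \<cdot> l"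
    using factor_ker[of f "s' \<cdot> l"] that unfolding \<kappa>_def by simp
  \<comment> \<open>Both \<open>f\<close> and \<open>f'\<close> preserve the component in
    \<open>D\<close>. Since \<open>f\<close> kills \<open>\<kappa>\<close>, that component of
    \<open>f' \<cdot> \<kappa>\<close> vanishes, and \<open>f' \<cdot> \<kappa>\<close> factors
    through \<open>l\<close> by some \<open>g\<close>.\<close>
  have "?c \<cdot> ?kB \<cdot> (f' \<cdot> \<kappa>) = copair (zero A D) (Id C D) \<cdot> (?kA \<cdot> (f \<cdot> \<kappa>))"
    by (simp add: reassoc[OF f'(4)] reassoc[OF f(4)] cosum_def del: \<kappa>(3))
  then have "?c \<cdot> ?kB \<cdot> (f' \<cdot> \<kappa>) = zero (Dom C \<kappa>) D" by simp
  then obtain g where g [simp]: "g \<in> Arr C" "Dom C g = Dom C \<kappa>" "Cod C g = Dom C l" "l \<cdot> g = f' \<cdot> \<kappa>"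
    using factor_ker[of "?c \<cdot> ?kB" "f' \<cdot> \<kappa>"] that unfolding l_def by simp
  have "g \<cdot> t = Id C (Dom C l)"
  proof (rule ker_mono[of "?c \<cdot> ?kB", folded l_def])
    have "l \<cdot> (g \<cdot> t) = f' \<cdot> (s' \<cdot> l)" by (simp add: reassoc[OF g(4)])
    then show "l \<cdot> (g \<cdot> t) = l \<cdot> Id C (Dom C l)" by (simp add: reassoc[OF fs'])
  qed (simp_all add: homI)
  then have pt_g: "is_point (Dom C l) g t" unfolding is_point_def by (simp add: homI)
  \<comment> \<open>First use of the point argument, over \<open>Dom C l\<close>: agreement on
    \<open>t\<close> comes from \<open>right\<close>, as
    \<open>\<kappa> \<cdot> t = s' \<cdot> l\<close>, and agreement on the kernel of
    \<open>g\<close> from \<open>cosmash\<close>.\<close>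
  have eq_\<kappa>: "u \<cdot> \<kappa> = v \<cdot> \<kappa>"
  proof (rule point_jointly_epic[OF pt_g, where P = P])
    show "u \<cdot> \<kappa> \<cdot> t = v \<cdot> \<kappa> \<cdot> t"
      using right unfolding s'_def[symmetric] by (simp add: reassoc[of u s' "v \<cdot> s'" l])
    define w where "w = ker g"
    have w [simp]: "w \<in> Arr C" "Cod C w = Dom C \<kappa>" "g \<cdot> w = zero (Dom C w) (Dom C l)"
      by (simp_all add: w_def)
    \<comment> \<open>All three collapses kill \<open>?a\<close>: that of \<open>D\<close> because
      \<open>?k\<close> is a kernel, that of \<open>B\<close> because \<open>f\<close> kills
      \<open>\<kappa>\<close>, and that of \<open>A\<close> because
      \<open>f' \<cdot> \<kappa> = l \<cdot> g\<close> and \<open>g\<close> kills \<open>w\<close>.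
      So \<open>?a\<close> factors through \<open>h3 A B D\<close>.\<close>
    let ?a = "?k \<cdot> (\<kappa> \<cdot> w)"
    have 1: "copair (Id C (A \<amalg> B)) (zero D (A \<amalg> B)) \<cdot> ?a = zero (Dom C ?a) (A \<amalg> B)"
      by (simp add: reassoc[OF kflat_simps(4)] del: Comp_copair_Comp)
    have 2: "copair (copair (inl A D) (zero B (A \<amalg> D))) (inr A D) \<cdot> ?a = zero (Dom C ?a) (A \<amalg> D)"
    proof -
      have "copair (copair (inl A D) (zero B (A \<amalg> D))) (inr A D) \<cdot> ?a = ?kA \<cdot> (f \<cdot> (\<kappa> \<cdot> w))"
        by (simp add: reassoc[OF f(4)] cosum_def)
      then show ?thesis by (simp add: reassoc[OF \<kappa>(3)])
    qed
    have 3: "copair (copair (zero A (B \<amalg> D)) (inl B D)) (inr B D) \<cdot> ?a = zero (Dom C ?a) (B \<amalg> D)"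
    proof -
      have "copair (copair (zero A (B \<amalg> D)) (inl B D)) (inr B D) \<cdot> ?a = ?kB \<cdot> (f' \<cdot> (\<kappa> \<cdot> w))"
        by (simp add: reassoc[OF f'(4)] cosum_def)
      also have "f' \<cdot> (\<kappa> \<cdot> w) = l \<cdot> (g \<cdot> w)" by (simp add: reassoc[OF g(4)] del: w(3))
      finally show ?thesis by simp
    qed
    obtain r where r [simp]: "r \<in> Arr C" "Dom C r = Dom C w" "Cod C r = Dom C (h3 A B D)" "h3 A B D \<cdot> r = ?a"
      using factor_h3[OF obj _ _ 1 2 3] that by simp
    have "\<kappa> \<cdot> w = j3 A B D \<cdot> r"
      by (rule kflat_mono[of "A \<amalg> B" D]) (simp_all add: homI reassoc[OF j3_simps(4)])
    then show "u \<cdot> \<kappa> \<cdot> ker g = v \<cdot> \<kappa> \<cdot> ker g"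
      unfolding w_def[symmetric] by (simp add: reassoc[OF cosmash])
  qed (simp_all add: homI)
  \<comment> \<open>Second use, over \<open>A \<flat> D\<close>: the kernel is handled by
    \<open>eq_\<kappa>\<close> and the section by \<open>left\<close>.\<close>
  show "u = v"
    by (rule point_jointly_epic[of "A \<flat> D" f s _ P])
      (use eq_\<kappa> left fs in \<open>simp_all add: is_point_def homI \<kappa>_def s_def\<close>)
qed

text \<open>Reassembles a morphism after \<open>Comp_copair\<close> has split it into its
  restrictions to the summands.\<close>

lemma copair_eta [simp]:
  assumes "f \<in> Arr C" "Dom C f = A \<amalg> B" "A \<in> Obj C" "B \<in> Obj C"
  shows "copair (f \<cdot> inl A B) (f \<cdot> inr A B) = f"
  by (rule cop_ext[of A B _ "Cod C f"]) (use assms in \<open>auto intro!: homI\<close>)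

subsection \<open>Peiffer products\<close>

lemma internal_actionD:
  assumes "internal_action A X \<xi>"
  shows "\<xi> \<in> Arr C" "Dom C \<xi> = A \<flat> X" "Cod C \<xi> = X"
  using assms homD unfolding internal_action_def by auto

text \<open>The equation is tested on the summands \<open>N \<flat> M\<close> and
  \<open>M \<flat> N\<close>. On the first, \<open>twist\<close> exchanges the two components of
  \<open>q\<close>.\<close>

lemma peiffer_coequalised_iff:
  assumes "M \<in> Obj C" "N \<in> Obj C" "q \<in> Arr C" "Dom C q = M \<amalg> N"
    and "internal_action M N \<xi>N" "internal_action N M \<xi>M"
  shows "q \<cdot> peiffer_inclusion M N = q \<cdot> cosum \<xi>M \<xi>N \<longleftrightarrow>
    copair (q \<cdot> inr M N) (q \<cdot> inl M N) \<cdot> kflat N M = q \<cdot> (inl M N \<cdot> \<xi>M) \<and>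
    q \<cdot> kflat M N = q \<cdot> (inr M N \<cdot> \<xi>N)"
  using assms(1-4) internal_actionD[OF assms(5)] internal_actionD[OF assms(6)]
  by (simp add: peiffer_inclusion_def twist_def cosum_def
      copair_eq_iff[of _ "N \<flat> M" "Cod C q" _ "M \<flat> N"] homI)

text \<open>Conjugation after \<open>1 \<flat> i_M\<close> is the copairing \<open>[1, i_M]\<close>
  restricted to the kernel; composing with \<open>q\<close> gives \<open>[q, q i_M]\<close>, and
  likewise for \<open>N\<close>.\<close>

lemma strong_peiffer_coequalised_iff:
  assumes "M \<in> Obj C" "N \<in> Obj C" "q \<in> Arr C" "Dom C q = M \<amalg> N"
    and "internal_action (M \<amalg> N) M \<zeta>M" "internal_action (M \<amalg> N) N \<zeta>N"
  shows "q \<cdot> (conjugation (M \<amalg> N) \<cdot>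
      copair (flat_map (Id C (M \<amalg> N)) (inl M N)) (flat_map (Id C (M \<amalg> N)) (inr M N))) =
      q \<cdot> cosum \<zeta>M \<zeta>N \<longleftrightarrow>
    copair q (q \<cdot> inl M N) \<cdot> kflat (M \<amalg> N) M = q \<cdot> (inl M N \<cdot> \<zeta>M) \<and>
    copair q (q \<cdot> inr M N) \<cdot> kflat (M \<amalg> N) N = q \<cdot> (inr M N \<cdot> \<zeta>N)"
  using assms(1-4) internal_actionD[OF assms(5)] internal_actionD[OF assms(6)]
  by (simp add: conjugation_def cosum_def
      copair_eq_iff[of _ "(M \<amalg> N) \<flat> M" "Cod C q" _ "(M \<amalg> N) \<flat> N"] homI)

lemma peiffer_coequalised_iff_strong:
  assumes obj: "M \<in> Obj C" "N \<in> Obj C" and q: "q \<in> Arr C" "Dom C q = M \<amalg> N"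
    and \<xi>N: "internal_action M N \<xi>N" and \<xi>M: "internal_action N M \<xi>M"
    and \<zeta>: "coproduct_actions M N \<xi>N \<xi>M \<zeta>M \<zeta>N"
  shows "q \<cdot> peiffer_inclusion M N = q \<cdot> cosum \<xi>M \<xi>N \<longleftrightarrow>
    q \<cdot> (conjugation (M \<amalg> N) \<cdot>
      copair (flat_map (Id C (M \<amalg> N)) (inl M N)) (flat_map (Id C (M \<amalg> N)) (inr M N))) =
      q \<cdot> cosum \<zeta>M \<zeta>N" (is "?P \<longleftrightarrow> ?S")
proof -
  have \<zeta>M: "internal_action (M \<amalg> N) M \<zeta>M" and \<zeta>N: "internal_action (M \<amalg> N) N \<zeta>N"
    and M: "\<zeta>M \<cdot> flat_map (inr M N) (Id C M) = \<xi>M"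
      "\<zeta>M \<cdot> flat_map (inl M N) (Id C M) = conjugation M"
      "\<zeta>M \<cdot> j3 M N M = \<xi>M \<cdot> i_cosmash N M \<cdot> fold_outer N M"
    and N: "\<zeta>N \<cdot> flat_map (inl M N) (Id C N) = \<xi>N"
      "\<zeta>N \<cdot> flat_map (inr M N) (Id C N) = conjugation N"
      "\<zeta>N \<cdot> j3 M N N = \<xi>N \<cdot> i_cosmash M N \<cdot> fold_right M N"
    using \<zeta> unfolding coproduct_actions_def by - (elim conjE, assumption)+
  note [simp] = obj q internal_actionD[OF \<xi>N] internal_actionD[OF \<xi>M]
    internal_actionD[OF \<zeta>M] internal_actionD[OF \<zeta>N]
    fold_outer_simps[OF obj] fold_right_simps[OF obj]
  note P_iff = peiffer_coequalised_iff[OF obj q \<xi>N \<xi>M]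
  note S_iff = strong_peiffer_coequalised_iff[OF obj q \<zeta>M \<zeta>N]
  show ?thesis
  proof
    assume ?P
    then have PM: "copair (q \<cdot> inr M N) (q \<cdot> inl M N) \<cdot> kflat N M = q \<cdot> (inl M N \<cdot> \<xi>M)"
      and PN: "q \<cdot> kflat M N = q \<cdot> (inr M N \<cdot> \<xi>N)"
      unfolding P_iff by auto
    have "copair q (q \<cdot> inl M N) \<cdot> kflat (M \<amalg> N) M = q \<cdot> (inl M N \<cdot> \<zeta>M)"
    proof (rule flat_map_jointly_epic[of M N M _ "Cod C q"])
      \<comment> \<open>On \<open>M + N + M\<close> the map \<open>[q, q i_M]\<close> treats both
        copies of \<open>M\<close> alike, so it factors through the fold. Then \<open>h3\<close> is
        rewritten through \<open>h2\<close>, and \<open>h2\<close> through \<open>kflat N M\<close>,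
        where \<open>PM\<close> applies.\<close>
      have "copair q (q \<cdot> inl M N) \<cdot> h3 M N M =
          copair (q \<cdot> inr M N) (q \<cdot> inl M N) \<cdot> (h2 N M \<cdot> fold_outer N M)" by simp
      also have "\<dots> = copair (q \<cdot> inr M N) (q \<cdot> inl M N) \<cdot> (kflat N M \<cdot> (i_cosmash N M \<cdot> fold_outer N M))"
        by (simp add: reassoc[OF i_cosmash_simps(4)] del: fold_outer_simps(4))
      also have "\<dots> = q \<cdot> (inl M N \<cdot> (\<xi>M \<cdot> (i_cosmash N M \<cdot> fold_outer N M)))"
        by (simp add: reassoc[OF PM])
      finally show "copair q (q \<cdot> inl M N) \<cdot> kflat (M \<amalg> N) M \<cdot> j3 M N M =
          q \<cdot> (inl M N \<cdot> \<zeta>M) \<cdot> j3 M N M" by (simp add: M)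
    \<comment> \<open>On \<open>M \<flat> M\<close> both sides are conjugation followed by
      \<open>q i_M\<close>; on \<open>N \<flat> M\<close> the equation is \<open>PM\<close>.\<close>
    qed (simp_all add: homI M conjugation_def cosum_def PM)
    moreover have "copair q (q \<cdot> inr M N) \<cdot> kflat (M \<amalg> N) N = q \<cdot> (inr M N \<cdot> \<zeta>N)"
    proof (rule flat_map_jointly_epic[of M N N _ "Cod C q"])
      \<comment> \<open>Now \<open>[q, q i_N]\<close> is \<open>q\<close> after folding the two
        copies of \<open>N\<close>.\<close>
      have "copair q (q \<cdot> inr M N) \<cdot> h3 M N N = q \<cdot> (h2 M N \<cdot> fold_right M N)" by simp
      also have "\<dots> = q \<cdot> (kflat M N \<cdot> (i_cosmash M N \<cdot> fold_right M N))"
        by (simp add: reassoc[OF i_cosmash_simps(4)] del: fold_right_simps(4))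
      also have "\<dots> = q \<cdot> (inr M N \<cdot> (\<xi>N \<cdot> (i_cosmash M N \<cdot> fold_right M N)))"
        by (simp add: reassoc[OF PN])
      finally show "copair q (q \<cdot> inr M N) \<cdot> kflat (M \<amalg> N) N \<cdot> j3 M N N =
          q \<cdot> (inr M N \<cdot> \<zeta>N) \<cdot> j3 M N N" by (simp add: N)
    qed (simp_all add: homI N conjugation_def cosum_def PN)
    ultimately show ?S unfolding S_iff ..
  next
    assume ?S
    then have SM: "copair q (q \<cdot> inl M N) \<cdot> kflat (M \<amalg> N) M = q \<cdot> (inl M N \<cdot> \<zeta>M)"
      and SN: "copair q (q \<cdot> inr M N) \<cdot> kflat (M \<amalg> N) N = q \<cdot> (inr M N \<cdot> \<zeta>N)"
      unfolding S_iff by auto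
    \<comment> \<open>The strong identity is restricted along \<open>N \<flat> M\<close>, where
      (CA.0) turns \<open>\<zeta>M\<close> into \<open>\<xi>M\<close>.\<close>
    have "copair (q \<cdot> inr M N) (q \<cdot> inl M N) \<cdot> kflat N M =
        copair q (q \<cdot> inl M N) \<cdot> (kflat (M \<amalg> N) M \<cdot> flat_map (inr M N) (Id C M))"
      by (simp add: cosum_def)
    also have "\<dots> = q \<cdot> (inl M N \<cdot> \<xi>M)"
      by (simp add: reassoc[OF SM] M del: flat_map_simps(4))
    finally have PM: "copair (q \<cdot> inr M N) (q \<cdot> inl M N) \<cdot> kflat N M = q \<cdot> (inl M N \<cdot> \<xi>M)" .
    have "q \<cdot> kflat M N = copair q (q \<cdot> inr M N) \<cdot> (kflat (M \<amalg> N) N \<cdot> flat_map (inl M N) (Id C N))"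
      by (simp add: cosum_def)
    also have "\<dots> = q \<cdot> (inr M N \<cdot> \<xi>N)"
      by (simp add: reassoc[OF SN] N del: flat_map_simps(4))
    finally show ?P unfolding P_iff using PM by simp
  qed
qed

end

theorem proposition3p8:
  fixes C :: "('o, 'm) cat" and M N P P\<^sub>S :: 'o and \<xi>N \<xi>M :: 'm
  assumes "semi_abelian_category C"
    and "category.smith_is_huq C"
    and "M \<in> Obj C" and "N \<in> Obj C"
    and "category.internal_action C M N \<xi>N"
    and "category.internal_action C N M \<xi>M"
    and "category.compatible_actions C M N \<xi>N \<xi>M"
    and "category.is_peiffer_product C M N \<xi>N \<xi>M P"
    and "category.is_strong_peiffer_product C M N \<xi>N \<xi>M P\<^sub>S"
  shows "category.isomorphic C P P\<^sub>S"
proof -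
  interpret semi_abelian_category C by fact
  obtain q where q: "q \<in> hom C (cop M N) P"
    and coeq: "is_coequaliser (peiffer_inclusion M N) (cosum \<xi>M \<xi>N) q"
    using assms(8) unfolding is_peiffer_product_def by blast
  obtain \<zeta>M \<zeta>N r where \<zeta>: "coproduct_actions M N \<xi>N \<xi>M \<zeta>M \<zeta>N"
    and r: "r \<in> hom C (cop M N) P\<^sub>S"
    and coeq': "is_coequaliser (conjugation (cop M N) \<cdot>\<^bsub>C\<^esub>
      copair (flat_map (Id C (cop M N)) (inl M N)) (flat_map (Id C (cop M N)) (inr M N)))
      (cosum \<zeta>M \<zeta>N) r"
    using assms(9) unfolding is_strong_peiffer_product_def by blast
  \<comment> \<open>The equivalence holds for every morphism out of \<open>cop M N\<close>. Applied
    to \<open>q\<close> and to \<open>r\<close>, it shows that each coequalises the pair of the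
    other.\<close>
  note iff = peiffer_coequalised_iff_strong[OF assms(3,4) _ _ assms(5,6) \<zeta>]
  have "isomorphic (Cod C q) (Cod C r)"
  proof (rule coequaliser_isomorphic[OF coeq coeq'])
    \<comment> \<open>A coequaliser starts at the codomain of its pair, and both \<open>q\<close>
      and \<open>r\<close> start at \<open>cop M N\<close>.\<close>
    show "Cod C (conjugation (cop M N) \<cdot>\<^bsub>C\<^esub>
      copair (flat_map (Id C (cop M N)) (inl M N)) (flat_map (Id C (cop M N)) (inr M N)))
      = Cod C (peiffer_inclusion M N)"
      using homD[OF is_coequaliserD(3)[OF coeq]] homD[OF is_coequaliserD(3)[OF coeq']]
        homD[OF q] homD[OF r] by simp
  qed (use iff[OF homD(1,2)[OF q]] iff[OF homD(1,2)[OF r]]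
      is_coequaliserD(4)[OF coeq] is_coequaliserD(4)[OF coeq'] in blast)+
  then show ?thesis using homD[OF q] homD[OF r] by simp
qed

end
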